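(* Let $\lambda=(\lambda_1\ge\dots\ge\lambda_n)\in\mathbb R^n$ be a dominant weight, and let the positive critical point $p_\lambda\in Z_{t^\lambda}(\mathbf K_{>0})$ of $\mathcal W_{t^\lambda}$ be written in the ideal coordinates $(m_1,\dots,m_N)$ (for $\mathbf i_0$). Put $\mu_k=\mathrm{Val}_{\mathbf K}(m_k)$ for $k=1,\dots,N$. Then $\{n_{ij}=\mu_{s_i+j-i}\}_{1\le i<j\le n}$ is an ideal filling for $\lambda$, where $s_i=\sum_{k=1}^{i-1}(n-k)$.
   Context: Let $\mathbf K$ be the field of generalised Puiseux series: series $c(t)=\sum_k c_{\mu_k}t^{\mu_k}$ with $c_{\mu_k}\in\mathbb C$ and real, strictly increasing exponents which are finite in number or tend to $+\infty$. $\mathbf K_{>0}$ is the set of nonzero series whose lowest order coefficient is in $\mathbb R_{>0}$, and $\mathrm{Val}_{\mathbf K}$ is the lowest exponent with non-zero coefficient. Let $n\ge2$, $N=\binom n2$. In $GL_n(\mathbf K)$ let $B,B_-$ be the upper/lower triangular matrices, $U\subset B$ the unipotent upper triangular matrices, $T$ the diagonal matrices. $\phi_i:SL_2\to GL_n$ embeds a $2\times 2$ matrix in rows and columns $i,i+1$; $\mathbf y_i(z)=\phi_i\begin{pmatrix}1&0\\ z&1\end{pmatrix}$, $\bar s_i=\phi_i\begin{pmatrix}0&-1\\1&0\end{pmatrix}$, and $\bar w_0=\bar s_{i_1}\cdots\bar s_{i_N}$ for any reduced expression of the longest element $w_0\in S_n$. $Z=B_-\cap B\bar w_0B$. Each $b\in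 Z$ is uniquely $b=u_1d\bar w_0u_2$ with $u_1,u_2\in U$, $d\in T$; put $\mathrm{hw}(b)=d$ and $\mathcal W(b)=\chi(u_1)+\chi(u_2)$ where $\chi(u)=\sum_{i=1}^{n-1}u_{i,i+1}$. For $\lambda\in\mathbb R^n$, $t^\lambda=\mathrm{diag}(t^{\lambda_1},\dots,t^{\lambda_n})$, $Z_{t^\lambda}(\mathbf K)=\{b\in Z:\mathrm{hw}(b)=t^\lambda\}$, and $\mathcal W_{t^\lambda}$ is the restriction of $\mathcal W$ to $Z_{t^\lambda}(\mathbf K)$. Let $\mathbf i_0=(i_1,\dots,i_N)=(1,2,\dots,n-1,\,1,2,\dots,n-2,\,\dots,\,1,2,\,1)$. The ideal coordinates $(d,\boldsymbol m)$ are given by the chart $$\psi(d,\boldsymbol m)=\mathbf y_{i_1}\big(\tfrac1{m_1}\big)\cdots\mathbf y_{i_N}\big(\tfrac1{m_N}\big)\,t_R(d,\boldsymbol m),$$ where $t_R(d,\boldsymbol m)$ is the diagonal matrix with $(n-j+1)$-th diagonal entry $d_j\prod_{k=1}^{j-1}m_{s_k+(j-k)}\big/\prod_{r=1}^{n-j}m_{s_j+r}$, $j=1,\dots,n$; one has $\mathrm{hw}(\psi(d,\boldsymbol m))=d$. $Z_{t^\lambda}(\mathbf K_{>0})$ is the (bijective) image of $(\mathbf K_{>0})^N$ under $\boldsymbol m\mapsto\psi(t^\lambda,\boldsymbol m)$. It is known (Judd, Judd–Rietsch) that for every dominant $\lambda\in\mathbb R^n$, $\mathcal W_{t^\lambda}$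 has exactly one critical point $p_\lambda$ in $Z_{t^\lambda}(\mathbf K_{>0})$. A filling is a collection $\{n_{ij}\}_{1\le i<j\le n}$ of non-negative reals; it is ideal if $n_{ij}=\max\{n_{i+1,j},n_{i,j-1}\}$ for $j-i\ge2$. It is an ideal filling for $\lambda$ if it is ideal and $\sum_{i<j}n_{ij}\alpha_{ij}+\ell\sum_{i}\epsilon_i=\lambda$, where $\ell=\frac1n\sum_i\lambda_i$, $\epsilon_i$ is the standard basis of $\mathbb R^n$ and $\alpha_{ij}=\epsilon_i-\epsilon_j$. *)

theory Defs
  imports Complex_Main "Jordan_Normal_Form.Matrix"
begin

section \<open>Generalised Puiseux series\<close>

text \<open>
  A series is given by its coefficient function. The support is finite or has exponents tending
  to infinity exactly if it meets every half-line bounded above in a finite set.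
\<close>

typedef puiseux = "{f :: real \<Rightarrow> complex. \<forall>r. finite {x. x \<le> r \<and> f x \<noteq> 0}}"
  morphisms pcoeff Abs_puiseux
  by (rule exI[of _ "\<lambda>_. 0"]) simp

setup_lifting type_definition_puiseux

lemma puiseux_eqI: "(\<And>x. pcoeff f x = pcoeff g x) \<Longrightarrow> f = g"
  by (simp add: pcoeff_inject[symmetric] fun_eq_iff)

lemma finite_pcoeff: "finite {x. x \<le> r \<and> pcoeff f x \<noteq> 0}"
  using pcoeff[of f] by simp

lemma finite_supp_bdd_below:
  fixes f :: "real \<Rightarrow> complex"
  assumes "\<And>r. finite {x. x \<le> r \<and> f x \<noteq> 0}"
  obtains A where "\<And>a. f a \<noteq> 0 \<Longrightarrow> A \<le> a"
proof -
  let ?S = "insert 0 {x. x \<le> 0 \<and> f x \<noteq> 0}"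
  have fin: "finite ?S" using assms by simp
  have "Min ?S \<le> a" if "f a \<noteq> 0" for a
  proof (cases "a \<le> 0")
    case True
    then show ?thesis using fin that by (intro Min_le) auto
  next
    case False
    have "Min ?S \<le> 0" using fin by (intro Min_le) auto
    then show ?thesis using False by linarith
  qed
  then show thesis by (rule that)
qed

lemma finite_supp_pairs_le:
  fixes f g :: "real \<Rightarrow> complex"
  assumes f: "\<And>r. finite {x. x \<le> r \<and> f x \<noteq> 0}"
    and g: "\<And>r. finite {x. x \<le> r \<and> g x \<noteq> 0}"
  shows "finite {(a, b). a + b \<le> r \<and> f a \<noteq> 0 \<and> g b \<noteq> 0}"
proof -
  obtain A where A: "\<And>a. f a \<noteq> 0 \<Longrightarrow> A \<le> a" using finite_supp_bdd_below[OF f] by blast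
  obtain B where B: "\<And>a. g a \<noteq> 0 \<Longrightarrow> B \<le> a" using finite_supp_bdd_below[OF g] by blast
  have "{(a, b). a + b \<le> r \<and> f a \<noteq> 0 \<and> g b \<noteq> 0}
      \<subseteq> {x. x \<le> r - B \<and> f x \<noteq> 0} \<times> {x. x \<le> r - A \<and> g x \<noteq> 0}"
  proof
    fix z
    assume "z \<in> {(a, b). a + b \<le> r \<and> f a \<noteq> 0 \<and> g b \<noteq> 0}"
    then obtain a b where z: "z = (a, b)" and *: "a + b \<le> r" "f a \<noteq> 0" "g b \<noteq> 0"
      by auto
    have "A \<le> a" "B \<le> b" using A B * by blast+
    then show "z \<in> {x. x \<le> r - B \<and> f x \<noteq> 0} \<times> {x. x \<le> r - A \<and> g x \<noteq> 0}"
      using * z by simp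
  qed
  then show ?thesis by (rule finite_subset) (intro finite_cartesian_product f g)
qed

instantiation puiseux :: comm_ring_1
begin

lift_definition zero_puiseux :: puiseux is "\<lambda>_. 0" by simp

lift_definition one_puiseux :: puiseux is "\<lambda>x. if x = 0 then 1 else 0"
  by (rule finite_subset[of _ "{0}"]) auto

lift_definition plus_puiseux :: "puiseux \<Rightarrow> puiseux \<Rightarrow> puiseux" is "\<lambda>f g x. f x + g x"
proof -
  fix f g :: "real \<Rightarrow> complex" and r :: real
  assume "\<And>r. finite {x. x \<le> r \<and> f x \<noteq> 0}" "\<And>r. finite {x. x \<le> r \<and> g x \<noteq> 0}"
  then have "finite ({x. x \<le> r \<and> f x \<noteq> 0} \<union> {x. x \<le> r \<and> g x \<noteq> 0})"
    by (intro finite_UnI)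
  then show "finite {x. x \<le> r \<and> f x + g x \<noteq> 0}"
    by (rule rev_finite_subset) auto
qed

lift_definition uminus_puiseux :: "puiseux \<Rightarrow> puiseux" is "\<lambda>f x. - f x" by simp

definition minus_puiseux :: "puiseux \<Rightarrow> puiseux \<Rightarrow> puiseux"
  where "minus_puiseux f g = f + - g"

lift_definition times_puiseux :: "puiseux \<Rightarrow> puiseux \<Rightarrow> puiseux"
  is "\<lambda>f g x. \<Sum>(a, b)\<in>{(a, b). a + b = x \<and> f a \<noteq> 0 \<and> g b \<noteq> 0}. f a * g b"
proof -
  fix f g :: "real \<Rightarrow> complex" and r :: real
  assume f: "\<And>r. finite {x. x \<le> r \<and> f x \<noteq> 0}" and g: "\<And>r. finite {x. x \<le> r \<and> g x \<noteq> 0}"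
  let ?h = "\<lambda>x. \<Sum>(a, b)\<in>{(a, b). a + b = x \<and> f a \<noteq> 0 \<and> g b \<noteq> 0}. f a * g b"
  have "{x. x \<le> r \<and> ?h x \<noteq> 0}
      \<subseteq> (\<lambda>(a, b). a + b) ` {(a, b). a + b \<le> r \<and> f a \<noteq> 0 \<and> g b \<noteq> 0}"
  proof
    fix x assume "x \<in> {x. x \<le> r \<and> ?h x \<noteq> 0}"
    then have x: "x \<le> r" "?h x \<noteq> 0" by auto
    have "{(a, b). a + b = x \<and> f a \<noteq> 0 \<and> g b \<noteq> 0} \<noteq> {}" using x(2) by (metis sum.empty)
    then obtain a b where "a + b = x" "f a \<noteq> 0" "g b \<noteq> 0" by auto
    then show "x \<in> (\<lambda>(a, b). a + b) ` {(a, b). a + b \<le> r \<and> f a \<noteq> 0 \<and> g b \<noteq> 0}"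
      using x(1) by (intro image_eqI[of _ _ "(a, b)"]) auto
  qed
  then show "finite {x. x \<le> r \<and> ?h x \<noteq> 0}"
    by (rule finite_subset) (intro finite_imageI finite_supp_pairs_le f g)
qed

lemma pcoeff_times_superset:
  assumes "finite P" "P \<subseteq> {(a, b). a + b = x}"
    and "\<And>a b. a + b = x \<Longrightarrow> pcoeff f a \<noteq> 0 \<Longrightarrow> pcoeff g b \<noteq> 0 \<Longrightarrow> (a, b) \<in> P"
  shows "pcoeff (f * g) x = (\<Sum>(a, b)\<in>P. pcoeff f a * pcoeff g b)"
  unfolding times_puiseux.rep_eq using assms by (intro sum.mono_neutral_left) auto

lemma finite_pairs_eq: "finite {(a, b). a + b = x \<and> pcoeff f a \<noteq> 0 \<and> pcoeff g b \<noteq> 0}"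
  by (rule finite_subset[OF _ finite_supp_pairs_le[OF finite_pcoeff finite_pcoeff, where r = x]]) auto

lemma finite_triples_eq:
  "finite {(a, b, c). a + b + c = x \<and> pcoeff f a \<noteq> 0 \<and> pcoeff g b \<noteq> 0 \<and> pcoeff h c \<noteq> 0}"
proof -
  obtain A where A: "\<And>a. pcoeff f a \<noteq> 0 \<Longrightarrow> A \<le> a"
    using finite_supp_bdd_below[OF finite_pcoeff] by blast
  obtain B where B: "\<And>a. pcoeff g a \<noteq> 0 \<Longrightarrow> B \<le> a"
    using finite_supp_bdd_below[OF finite_pcoeff] by blast
  obtain C where C: "\<And>a. pcoeff h a \<noteq> 0 \<Longrightarrow> C \<le> a"
    using finite_supp_bdd_below[OF finite_pcoeff] by blast
  have "{(a, b, c). a + b + c = x \<and> pcoeff f a \<noteq> 0 \<and> pcoeff g b \<noteq> 0 \<and> pcoeff h c \<noteq> 0}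
     \<subseteq> {a. a \<le> x - B - C \<and> pcoeff f a \<noteq> 0} \<times> {a. a \<le> x - A - C \<and> pcoeff g a \<noteq> 0}
        \<times> {a. a \<le> x - A - B \<and> pcoeff h a \<noteq> 0}"
  proof
    fix z
    assume "z \<in> {(a, b, c). a + b + c = x \<and> pcoeff f a \<noteq> 0 \<and> pcoeff g b \<noteq> 0 \<and> pcoeff h c \<noteq> 0}"
    then obtain a b c where z: "z = (a, b, c)" and x: "a + b + c = x"
      and *: "pcoeff f a \<noteq> 0" "pcoeff g b \<noteq> 0" "pcoeff h c \<noteq> 0"
      by auto
    have "A \<le> a" "B \<le> b" "C \<le> c" using A B C * by blast+
    then show "z \<in> {a. a \<le> x - B - C \<and> pcoeff f a \<noteq> 0} \<times> {a. a \<le> x - A - C \<and> pcoeff g a \<noteq> 0}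
        \<times> {a. a \<le> x - A - B \<and> pcoeff h a \<noteq> 0}"
      using * z x by simp
  qed
  then show ?thesis
    by (rule finite_subset) (intro finite_cartesian_product finite_pcoeff)
qed

lemma puiseux_mult_commute: "f * g = g * (f :: puiseux)"
proof (rule puiseux_eqI)
  fix x
  show "pcoeff (f * g) x = pcoeff (g * f) x"
    unfolding times_puiseux.rep_eq
    by (rule sum.reindex_bij_witness[of _ prod.swap prod.swap])
       (auto simp: add.commute mult.commute)
qed

lemma pcoeff_times_triple:
  "pcoeff (f * g * h) x =
     (\<Sum>(a, b, c)\<in>{(a, b, c). a + b + c = x \<and> pcoeff f a \<noteq> 0 \<and> pcoeff g b \<noteq> 0 \<and> pcoeff h c \<noteq> 0}.
        pcoeff f a * pcoeff g b * pcoeff h c)"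
proof -
  let ?T = "{(a, b, c). a + b + c = x \<and> pcoeff f a \<noteq> 0 \<and> pcoeff g b \<noteq> 0 \<and> pcoeff h c \<noteq> 0}"
  let ?Q = "\<lambda>e. {(a, b). a + b = e \<and> pcoeff f a \<noteq> 0 \<and> pcoeff g b \<noteq> 0}"
  define P where "P = (\<lambda>(a, b, c). (a + b, c)) ` ?T"
  have finP: "finite P" unfolding P_def by (intro finite_imageI finite_triples_eq)
  have "pcoeff (f * g * h) x = (\<Sum>(e, c)\<in>P. pcoeff (f * g) e * pcoeff h c)"
  proof (rule pcoeff_times_superset[OF finP])
    show "P \<subseteq> {(a, b). a + b = x}" unfolding P_def by auto
  next
    fix e c assume e: "e + c = x" "pcoeff (f * g) e \<noteq> 0" "pcoeff h c \<noteq> 0"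
    have "?Q e \<noteq> {}" using e(2) unfolding times_puiseux.rep_eq by (metis sum.empty)
    then obtain a b where "a + b = e" "pcoeff f a \<noteq> 0" "pcoeff g b \<noteq> 0" by auto
    then have "(a, b, c) \<in> ?T" "(e, c) = (\<lambda>(a, b, c). (a + b, c)) (a, b, c)" using e by auto
    then show "(e, c) \<in> P" unfolding P_def by (metis (no_types, lifting) image_eqI)
  qed
  also have "\<dots> = (\<Sum>p\<in>P. \<Sum>q\<in>?Q (fst p). pcoeff f (fst q) * pcoeff g (snd q) * pcoeff h (snd p))"
    by (intro sum.cong refl) (auto simp: times_puiseux.rep_eq sum_distrib_right case_prod_beta)
  also have "\<dots> = (\<Sum>(p, q)\<in>(SIGMA p:P. ?Q (fst p)).
                     pcoeff f (fst q) * pcoeff g (snd q) * pcoeff h (snd p))"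
    by (rule sum.Sigma) (use finP finite_pairs_eq in auto)
  also have "\<dots> = (\<Sum>(a, b, c)\<in>?T. pcoeff f a * pcoeff g b * pcoeff h c)"
  proof (rule sum.reindex_bij_witness[of _ "\<lambda>(a, b, c). ((a + b, c), (a, b))"
        "\<lambda>(p, q). (fst q, snd q, snd p)"], goal_cases)
    case (2 z)
    then obtain p q where z: "z = (p, q)" "p \<in> P" "q \<in> ?Q (fst p)" by auto
    from z(2) obtain a b c where "(a, b, c) \<in> ?T" "p = (a + b, c)" unfolding P_def by auto
    with z show ?case by auto
  next
    case (4 z)
    then obtain a b c where z: "z = (a, b, c)" "(a, b, c) \<in> ?T" by auto
    from z(2) have "(\<lambda>(a, b, c). (a + b, c)) (a, b, c) \<in> P" unfolding P_def by (rule imageI)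
    with z show ?case by simp
  qed auto
  finally show ?thesis .
qed

lemma puiseux_mult_assoc: "f * g * h = f * (g * (h :: puiseux))"
proof (rule puiseux_eqI)
  fix x
  have "pcoeff (f * g * h) x = pcoeff (g * h * f) x"
    unfolding pcoeff_times_triple
    by (rule sum.reindex_bij_witness[of _ "\<lambda>(b, c, a). (a, b, c)" "\<lambda>(a, b, c). (b, c, a)"]) auto
  then show "pcoeff (f * g * h) x = pcoeff (f * (g * h)) x"
    using puiseux_mult_commute[of "g * h" f] by simp
qed

instance
proof
  fix f g h :: puiseux
  show "f * g * h = f * (g * h)" by (rule puiseux_mult_assoc)
  show "f * g = g * f" by (rule puiseux_mult_commute)
  show "1 * f = f"
  proof (rule puiseux_eqI)
    fix x
    have "pcoeff (1 * f) x = (\<Sum>(a, b)\<in>{(0, x)}. pcoeff 1 a * pcoeff f b)"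
      by (rule pcoeff_times_superset) (auto simp: one_puiseux.rep_eq split: if_splits)
    then show "pcoeff (1 * f) x = pcoeff f x" by (simp add: one_puiseux.rep_eq)
  qed
  show "(f + g) * h = f * h + g * h"
  proof (rule puiseux_eqI)
    fix x
    define P where "P = {(a, b). a + b = x \<and> pcoeff f a \<noteq> 0 \<and> pcoeff h b \<noteq> 0}
      \<union> {(a, b). a + b = x \<and> pcoeff g a \<noteq> 0 \<and> pcoeff h b \<noteq> 0}"
    have P: "finite P" "P \<subseteq> {(a, b). a + b = x}"
      unfolding P_def using finite_pairs_eq by auto
    have "pcoeff ((f + g) * h) x = (\<Sum>(a, b)\<in>P. pcoeff (f + g) a * pcoeff h b)"
      by (rule pcoeff_times_superset[OF P]) (auto simp: P_def plus_puiseux.rep_eq)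
    also have "\<dots> = (\<Sum>(a, b)\<in>P. pcoeff f a * pcoeff h b) + (\<Sum>(a, b)\<in>P. pcoeff g a * pcoeff h b)"
      by (simp add: sum.distrib[symmetric] case_prod_beta plus_puiseux.rep_eq algebra_simps)
    also have "(\<Sum>(a, b)\<in>P. pcoeff f a * pcoeff h b) = pcoeff (f * h) x"
      by (rule pcoeff_times_superset[OF P, symmetric]) (auto simp: P_def)
    also have "(\<Sum>(a, b)\<in>P. pcoeff g a * pcoeff h b) = pcoeff (g * h) x"
      by (rule pcoeff_times_superset[OF P, symmetric]) (auto simp: P_def)
    finally show "pcoeff ((f + g) * h) x = pcoeff (f * h + g * h) x"
      by (simp add: plus_puiseux.rep_eq)
  qed
  show "(0 :: puiseux) \<noteq> 1"
  proof
    assume "(0 :: puiseux) = 1"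
    then have "pcoeff 0 0 = pcoeff 1 0" by simp
    then show False by (simp add: zero_puiseux.rep_eq one_puiseux.rep_eq)
  qed
qed (auto intro!: puiseux_eqI
       simp: plus_puiseux.rep_eq uminus_puiseux.rep_eq zero_puiseux.rep_eq minus_puiseux_def)

end

definition Val :: "puiseux \<Rightarrow> real" where
  "Val c = (LEAST \<mu>. pcoeff c \<mu> \<noteq> 0)"

definition puiseux_pos :: "puiseux set" where
  "puiseux_pos = {c. c \<noteq> 0 \<and> (\<exists>r::real. r > 0 \<and> pcoeff c (Val c) = complex_of_real r)}"

lift_definition tpow :: "real \<Rightarrow> puiseux" is "\<lambda>\<mu> x. if x = \<mu> then 1 else 0"
  by (rule finite_subset[of _ "{_}"]) auto

lemma Val_props:
  assumes "c \<noteq> 0"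
  shows pcoeff_Val: "pcoeff c (Val c) \<noteq> 0"
    and Val_le: "pcoeff c x \<noteq> 0 \<Longrightarrow> Val c \<le> x"
proof -
  obtain y where y: "pcoeff c y \<noteq> 0"
    using assms puiseux_eqI[of c 0] by (auto simp: zero_puiseux.rep_eq)
  let ?S = "{x. x \<le> y \<and> pcoeff c x \<noteq> 0}"
  have S: "finite ?S" "?S \<noteq> {}" using y finite_pcoeff by auto
  have min: "pcoeff c (Min ?S) \<noteq> 0" "Min ?S \<le> y" using Min_in[OF S] by auto
  have le: "Min ?S \<le> x" if "pcoeff c x \<noteq> 0" for x
  proof (cases "x \<le> y")
    case True
    then show ?thesis using S(1) that by (intro Min_le) auto
  next
    case False
    then show ?thesis using min(2) by linarith
  qed
  have eq: "Val c = Min ?S" unfolding Val_def by (rule Least_equality) (use min le in auto)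
  show "pcoeff c (Val c) \<noteq> 0" using min eq by simp
  show "Val c \<le> x" if "pcoeff c x \<noteq> 0" using le[OF that] eq by simp
qed

text \<open>Inverses exist by the geometric series.\<close>

lemma pcoeff_minus: "pcoeff (f - g) x = pcoeff f x - pcoeff g x"
  by (simp only: minus_puiseux_def plus_puiseux.rep_eq uminus_puiseux.rep_eq diff_conv_add_uminus)

lemma supp_times:
  assumes "pcoeff (f * g) x \<noteq> 0"
  obtains a b where "a + b = x" "pcoeff f a \<noteq> 0" "pcoeff g b \<noteq> 0"
proof -
  have "{(a, b). a + b = x \<and> pcoeff f a \<noteq> 0 \<and> pcoeff g b \<noteq> 0} \<noteq> {}"
    using assms unfolding times_puiseux.rep_eq by (metis sum.empty)
  then show thesis using that by auto
qed

lemma pcoeff_sum: "pcoeff (sum F A) x = (\<Sum>k\<in>A. pcoeff (F k) x)"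
  by (induction A rule: infinite_finite_induct)
     (auto simp: zero_puiseux.rep_eq plus_puiseux.rep_eq)

lemma one_minus_inverse:
  fixes y :: puiseux
  assumes d: "\<delta> > 0" and y: "\<And>x. pcoeff y x \<noteq> 0 \<Longrightarrow> \<delta> \<le> x"
  obtains g where "(1 - y) * g = 1"
proof -
  have pw: "real k * \<delta> \<le> x" if "pcoeff (y ^ k) x \<noteq> 0" for k x
    using that
  proof (induction k arbitrary: x)
    case 0
    then show ?case by (auto simp: one_puiseux.rep_eq split: if_splits)
  next
    case (Suc k)
    then obtain a b where "a + b = x" "pcoeff y a \<noteq> 0" "pcoeff (y ^ k) b \<noteq> 0"
      by (auto elim: supp_times)
    then show ?case using Suc.IH[of b] y[of a] by (simp add: algebra_simps)
  qed
  define N where "N = (\<lambda>x::real. nat \<lceil>x / \<delta>\<rceil>)"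
  have N: "pcoeff (y ^ k) x = 0" if "k > N r" "x \<le> r" for k x r
  proof (rule ccontr)
    assume "pcoeff (y ^ k) x \<noteq> 0"
    then have "real k * \<delta> \<le> r" using pw[of k x] that(2) by linarith
    then have "real k \<le> r / \<delta>" using d by (simp add: field_simps)
    then have "k \<le> N r" unfolding N_def by linarith
    then show False using that by simp
  qed
  define S where "S = (\<lambda>n. \<Sum>k\<le>n. y ^ k)"
  have tail: "pcoeff (S n) x = pcoeff (S (N r)) x" if "n \<ge> N r" "x \<le> r" for n r x
    unfolding S_def pcoeff_sum
  proof (rule sum.mono_neutral_right)
    show "\<forall>k\<in>{..n} - {..N r}. pcoeff (y ^ k) x = 0" using N[of r _ x] that(2) by auto
  qed (use that(1) in auto)
  define g where "g = Abs_puiseux (\<lambda>x. pcoeff (S (N x)) x)"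
  have Nmono: "N x \<le> N r" if "x \<le> r" for x r
  proof -
    have "x / \<delta> \<le> r / \<delta>" using that d by (simp add: divide_right_mono)
    then show ?thesis unfolding N_def by (rule nat_mono[OF ceiling_mono])
  qed
  have tail2: "pcoeff (S (N x)) x = pcoeff (S (N r)) x" if "x \<le> r" for x r
    using tail[of x "N r" x] Nmono[OF that] by simp
  have "finite {x. x \<le> r \<and> pcoeff (S (N x)) x \<noteq> 0}" for r
    by (rule finite_subset[OF _ finite_pcoeff[of r "S (N r)"]]) (auto simp: tail2)
  then have g: "pcoeff g x = pcoeff (S (N x)) x" for x
    unfolding g_def by (subst Abs_puiseux_inverse) auto
  have "(1 - y) * g = 1"
  proof (rule puiseux_eqI)
    fix x
    have nonneg: "a \<ge> 0" if "pcoeff (1 - y) a \<noteq> 0" for a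
    proof (cases "a = 0")
      case False
      then have "pcoeff y a \<noteq> 0"
        using that
        by (auto simp: pcoeff_minus one_puiseux.rep_eq)
      then show ?thesis using y[of a] d by simp
    qed simp
    let ?h = "S (N x)"
    have eq: "pcoeff g b = pcoeff ?h b" if "b \<le> x" for b
      using tail2[OF that] by (simp only: g)
    have "pcoeff ((1 - y) * g) x = pcoeff ((1 - y) * ?h) x"
    proof -
      have *: "pcoeff g b = pcoeff ?h b" if "a + b = x" "pcoeff (1 - y) a \<noteq> 0" for a b
        by (rule eq) (use nonneg[OF that(2)] that(1) in linarith)
      have "{(a, b). a + b = x \<and> pcoeff (1 - y) a \<noteq> 0 \<and> pcoeff g b \<noteq> 0}
          = {(a, b). a + b = x \<and> pcoeff (1 - y) a \<noteq> 0 \<and> pcoeff ?h b \<noteq> 0}"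
        by (intro Collect_cong, clarify) (metis *)
      then show ?thesis
        unfolding times_puiseux.rep_eq
      proof (rule sum.cong)
        fix p
        assume "p \<in> {(a, b). a + b = x \<and> pcoeff (1 - y) a \<noteq> 0 \<and> pcoeff ?h b \<noteq> 0}"
        then have "pcoeff g (snd p) = pcoeff ?h (snd p)" by (intro *[of "fst p"]) auto
        then show "(case p of (a, b) \<Rightarrow> pcoeff (1 - y) a * pcoeff g b)
            = (case p of (a, b) \<Rightarrow> pcoeff (1 - y) a * pcoeff ?h b)"
          by (simp add: case_prod_beta)
      qed
    qed
    also have "(1 - y) * ?h = 1 - y ^ Suc (N x)"
      unfolding S_def by (rule sum_gp_basic)
    also have "pcoeff (1 - y ^ Suc (N x)) x = pcoeff 1 x"
      using N[of x "Suc (N x)" x]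
      by (simp add: pcoeff_minus del: power_Suc)
    finally show "pcoeff ((1 - y) * g) x = pcoeff 1 x" .
  qed
  then show thesis by (rule that)
qed

lift_definition pmonom :: "complex \<Rightarrow> real \<Rightarrow> puiseux" is "\<lambda>c \<mu> x. if x = \<mu> then c else 0"
  by (rule finite_subset[of _ "{_}"]) auto

lemma pcoeff_pmonom_times: "pcoeff (pmonom c \<mu> * f) x = c * pcoeff f (x - \<mu>)"
proof -
  have "pcoeff (pmonom c \<mu> * f) x = (\<Sum>(a, b)\<in>{(\<mu>, x - \<mu>)}. pcoeff (pmonom c \<mu>) a * pcoeff f b)"
    by (rule pcoeff_times_superset) (auto simp: pmonom.rep_eq split: if_splits)
  then show ?thesis by (simp add: pmonom.rep_eq)
qed

lemma puiseux_inverse_exists: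
  fixes f :: puiseux
  assumes "f \<noteq> 0"
  shows "\<exists>g. f * g = 1"
proof -
  let ?v = "Val f" and ?c = "pcoeff f (Val f)"
  have c: "?c \<noteq> 0" using pcoeff_Val[OF assms] .
  let ?m = "pmonom (inverse ?c) (- ?v)"
  define y where "y = 1 - ?m * f"
  have yc: "pcoeff y x = (if x = 0 then 1 else 0) - inverse ?c * pcoeff f (x + ?v)" for x
    by (simp add: y_def pcoeff_minus one_puiseux.rep_eq pcoeff_pmonom_times)
  have pos: "x > 0" if "pcoeff y x \<noteq> 0" for x
  proof -
    have "x \<noteq> 0" using that c by (auto simp: yc)
    then have "pcoeff f (x + ?v) \<noteq> 0" using that by (auto simp: yc)
    then have "?v \<le> x + ?v" by (rule Val_le[OF assms])
    then show "x > 0" using \<open>x \<noteq> 0\<close> by simp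
  qed
  have "\<exists>\<delta>>0. \<forall>x. pcoeff y x \<noteq> 0 \<longrightarrow> \<delta> \<le> x"
  proof (cases "y = 0")
    case True
    then show ?thesis by (intro exI[of _ 1]) (simp add: zero_puiseux.rep_eq)
  next
    case False
    then show ?thesis using pos[OF pcoeff_Val[OF False]] Val_le[OF False] by blast
  qed
  then obtain g where "(1 - y) * g = 1" using one_minus_inverse by metis
  then have "f * (?m * g) = 1" by (simp add: y_def mult.assoc mult.left_commute)
  then show ?thesis by blast
qed

instantiation puiseux :: field
begin

definition inverse_puiseux :: "puiseux \<Rightarrow> puiseux" where
  "inverse_puiseux f = (if f = 0 then 0 else (THE g. f * g = 1))"

definition divide_puiseux :: "puiseux \<Rightarrow> puiseux \<Rightarrow> puiseux" where
  "divide_puiseux f g = f * inverse g"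

instance
proof
  fix f g :: puiseux
  show "inverse f * f = 1" if f: "f \<noteq> 0"
  proof -
    obtain h where h: "f * h = 1" using puiseux_inverse_exists[OF f] by blast
    have uniq: "h' = h" if "f * h' = 1" for h'
    proof -
      have "h' = h' * (f * h)" using h by simp
      also have "\<dots> = (f * h') * h" by (simp only: ac_simps)
      finally show ?thesis using that by simp
    qed
    have "(THE g. f * g = 1) = h" by (rule the_equality) (rule h, rule uniq)
    then have "inverse f = h" using f by (simp add: inverse_puiseux_def)
    then show ?thesis using h by (simp add: mult.commute)
  qed
  show "f div g = f * inverse g" by (rule divide_puiseux_def)
  show "inverse (0 :: puiseux) = 0" by (simp add: inverse_puiseux_def)
qed

end


section \<open>Dual numbers\<close>

text \<open>
  The ring \<open>R[\<epsilon>]/(\<epsilon>\<^sup>2)\<close>; \<open>Dual a b\<close> is \<open>a + b \<epsilon>\<close>. A tangent vector of an algebraic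
  variety at a point is a point over the dual numbers lifting it, and the differential of a
  regular function sends it to the \<open>\<epsilon>\<close>-part of its value.
\<close>

datatype 'a dual_number = Dual (dual_std: 'a) (dual_eps: 'a)

instantiation dual_number :: (comm_ring_1) comm_ring_1
begin

definition "0 = Dual 0 0"
definition "1 = Dual 1 0"
definition "x + y = Dual (dual_std x + dual_std y) (dual_eps x + dual_eps y)"
definition "- x = Dual (- dual_std x) (- dual_eps x)"
definition "x - y = Dual (dual_std x - dual_std y) (dual_eps x - dual_eps y)"
definition "x * y =
  Dual (dual_std x * dual_std y) (dual_std x * dual_eps y + dual_eps x * dual_std y)"

instance
  by standard
    (auto simp: zero_dual_number_def one_dual_number_def plus_dual_number_def
      uminus_dual_number_def minus_dual_number_def times_dual_number_def algebra_simps
      intro!: dual_number.expand)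

end

abbreviation dual_const :: "'a::comm_ring_1 \<Rightarrow> 'a dual_number" where
  "dual_const a \<equiv> Dual a 0"


section \<open>The general linear group\<close>

text \<open>
  Matrix entries are indexed from 0 here, whereas rows and columns are numbered from 1 in the
  mathematics, so that entry \<open>(i, j)\<close> becomes \<open>A $$ (i - 1, j - 1)\<close>. The groups are defined over
  any commutative ring, because they are also needed over the dual numbers.
\<close>

definition GL :: "nat \<Rightarrow> 'a::comm_ring_1 mat set" where
  "GL n = {A \<in> carrier_mat n n. invertible_mat A}"

definition borel_upper :: "nat \<Rightarrow> 'a::comm_ring_1 mat set" where
  "borel_upper n = {A \<in> GL n. upper_triangular A}"

definition borel_lower :: "nat \<Rightarrow> 'a::comm_ring_1 mat set" where
  "borel_lower n = {A \<in> GL n. upper_triangular (transpose_mat A)}"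

definition unipotent_upper :: "nat \<Rightarrow> 'a::comm_ring_1 mat set" where
  "unipotent_upper n = {A \<in> borel_upper n. \<forall>i<n. A $$ (i, i) = 1}"

definition torus :: "nat \<Rightarrow> 'a::comm_ring_1 mat set" where
  "torus n = {A \<in> GL n. diagonal_mat A}"

definition mat_product :: "nat \<Rightarrow> 'a::comm_ring_1 mat list \<Rightarrow> 'a mat" where
  "mat_product n As = foldr (*) As (1\<^sub>m n)"

definition phi :: "nat \<Rightarrow> nat \<Rightarrow> 'a::comm_ring_1 mat \<Rightarrow> 'a mat" where
  "phi n i M = mat n n (\<lambda>(r, c).
     if r \<in> {i - 1, i} \<and> c \<in> {i - 1, i} then M $$ (r - (i - 1), c - (i - 1))
     else if r = c then 1 else 0)"

definition y_mat :: "nat \<Rightarrow> nat \<Rightarrow> 'a::comm_ring_1 \<Rightarrow> 'a mat" where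
  "y_mat n i z = phi n i (mat_of_rows_list 2 [[1, 0], [z, 1]])"

definition s_bar :: "nat \<Rightarrow> nat \<Rightarrow> 'a::comm_ring_1 mat" where
  "s_bar n i = phi n i (mat_of_rows_list 2 [[0, - 1], [1, 0]])"

definition word_i0 :: "nat \<Rightarrow> nat list" where
  "word_i0 n = concat (map (\<lambda>k. [1..<Suc (n - k)]) [1..<n])"

text \<open>
  The word \<open>word_i0 n\<close> is a reduced expression of the longest element. The matrix below does not
  depend on the choice of reduced expression, by the braid relations.
\<close>

definition w0_bar :: "nat \<Rightarrow> 'a::comm_ring_1 mat" where
  "w0_bar n = mat_product n (map (s_bar n) (word_i0 n))"


section \<open>The superpotential and its critical points\<close>

definition Z :: "nat \<Rightarrow> 'a::comm_ring_1 mat set" where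
  "Z n = borel_lower n \<inter> {b1 * w0_bar n * b2 | b1 b2. b1 \<in> borel_upper n \<and> b2 \<in> borel_upper n}"

definition chi :: "nat \<Rightarrow> 'a::comm_ring_1 mat \<Rightarrow> 'a" where
  "chi n u = (\<Sum>i=1..n - 1. u $$ (i - 1, i))"

definition hw :: "nat \<Rightarrow> 'a::comm_ring_1 mat \<Rightarrow> 'a mat" where
  "hw n b = (THE d. d \<in> torus n \<and>
     (\<exists>u1\<in>unipotent_upper n. \<exists>u2\<in>unipotent_upper n. b = u1 * d * w0_bar n * u2))"

definition superpotential :: "nat \<Rightarrow> 'a::comm_ring_1 mat \<Rightarrow> 'a" where
  "superpotential n b = (THE w. \<exists>u1\<in>unipotent_upper n. \<exists>d\<in>torus n. \<exists>u2\<in>unipotent_upper n.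
     b = u1 * d * w0_bar n * u2 \<and> w = chi n u1 + chi n u2)"

definition Z_fibre :: "nat \<Rightarrow> 'a::comm_ring_1 mat \<Rightarrow> 'a mat set" where
  "Z_fibre n d = {b \<in> Z n. hw n b = d}"

text \<open>
  A point of the variety \<open>Z_fibre n d\<close> is critical if the differential of the restricted
  superpotential vanishes on every tangent vector at that point.
\<close>

definition critical_point :: "nat \<Rightarrow> 'a::comm_ring_1 mat \<Rightarrow> 'a mat \<Rightarrow> bool" where
  "critical_point n d p \<longleftrightarrow> p \<in> Z_fibre n d \<and>
     (\<forall>q \<in> Z_fibre n (map_mat dual_const d). map_mat dual_std q = p \<longrightarrow>
        dual_eps (superpotential n q) = 0)"


section \<open>Ideal coordinates\<close>

definition s_index :: "nat \<Rightarrow> nat \<Rightarrow> nat" where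
  "s_index n i = (\<Sum>k=1..i - 1. n - k)"

text \<open>Coordinate vectors \<open>m\<close> are functions used at the indices \<open>1, \<dots>, n choose 2\<close> only.\<close>

definition t_R_entry :: "nat \<Rightarrow> 'a::field mat \<Rightarrow> (nat \<Rightarrow> 'a) \<Rightarrow> nat \<Rightarrow> 'a" where
  "t_R_entry n d m j = d $$ (j - 1, j - 1) * (\<Prod>k=1..j - 1. m (s_index n k + (j - k)))
     / (\<Prod>r=1..n - j. m (s_index n j + r))"

text \<open>
  The \<open>j\<close>-th value is the diagonal entry number \<open>n - j + 1\<close>, that is, the one at the 0-based
  position \<open>i = n - j\<close>.
\<close>

definition t_R :: "nat \<Rightarrow> 'a::field mat \<Rightarrow> (nat \<Rightarrow> 'a) \<Rightarrow> 'a mat" where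
  "t_R n d m = mat_diag n (\<lambda>i. t_R_entry n d m (n - i))"

definition psi :: "nat \<Rightarrow> 'a::field mat \<Rightarrow> (nat \<Rightarrow> 'a) \<Rightarrow> 'a mat" where
  "psi n d m =
     mat_product n (map (\<lambda>k. y_mat n (word_i0 n ! (k - 1)) (1 / m k)) [1..<Suc (n choose 2)])
     * t_R n d m"

definition positive_coords :: "nat \<Rightarrow> (nat \<Rightarrow> puiseux) set" where
  "positive_coords n = {m. \<forall>k\<in>{1..n choose 2}. m k \<in> puiseux_pos}"

definition Z_fibre_pos :: "nat \<Rightarrow> puiseux mat \<Rightarrow> puiseux mat set" where
  "Z_fibre_pos n d = psi n d ` positive_coords n"

definition dominant :: "nat \<Rightarrow> (nat \<Rightarrow> real) \<Rightarrow> bool" where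
  "dominant n lam \<longleftrightarrow> (\<forall>i\<in>{1..<n}. lam (i + 1) \<le> lam i)"

definition t_weight :: "nat \<Rightarrow> (nat \<Rightarrow> real) \<Rightarrow> puiseux mat" where
  "t_weight n lam = mat_diag n (\<lambda>i. tpow (lam (i + 1)))"

definition positive_critical_point :: "nat \<Rightarrow> (nat \<Rightarrow> real) \<Rightarrow> puiseux mat \<Rightarrow> bool" where
  "positive_critical_point n lam p \<longleftrightarrow>
     p \<in> Z_fibre_pos n (t_weight n lam) \<and> critical_point n (t_weight n lam) p"


section \<open>Ideal fillings\<close>

definition filling :: "nat \<Rightarrow> (nat \<Rightarrow> nat \<Rightarrow> real) \<Rightarrow> bool" where
  "filling n f \<longleftrightarrow> (\<forall>i j. 1 \<le> i \<and> i < j \<and> j \<le> n \<longrightarrow> 0 \<le> f i j)"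

definition ideal_filling :: "nat \<Rightarrow> (nat \<Rightarrow> nat \<Rightarrow> real) \<Rightarrow> bool" where
  "ideal_filling n f \<longleftrightarrow> filling n f \<and>
     (\<forall>i j. 1 \<le> i \<and> j \<le> n \<and> i + 2 \<le> j \<longrightarrow> f i j = max (f (i + 1) j) (f i (j - 1)))"

definition eps_vec :: "nat \<Rightarrow> nat \<Rightarrow> real" where
  "eps_vec i = (\<lambda>k. if k = i then 1 else 0)"

definition alpha_vec :: "nat \<Rightarrow> nat \<Rightarrow> nat \<Rightarrow> real" where
  "alpha_vec i j = (\<lambda>k. eps_vec i k - eps_vec j k)"

definition ideal_filling_for :: "nat \<Rightarrow> (nat \<Rightarrow> real) \<Rightarrow> (nat \<Rightarrow> nat \<Rightarrow> real) \<Rightarrow> bool" where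
  "ideal_filling_for n lam f \<longleftrightarrow> ideal_filling n f \<and>
     (let l = (\<Sum>i=1..n. lam i) / real n in
      \<forall>k\<in>{1..n}. (\<Sum>i=1..n. \<Sum>j=i + 1..n. f i j * alpha_vec i j k)
                  + l * (\<Sum>i=1..n. eps_vec i k) = lam k)"

end

theory Submission
  imports Defs "Jordan_Normal_Form.Determinant" "HOL-Computational_Algebra.Polynomial"
begin

text \<open>
  Moving \<open>b = u\<^sub>1 d w\<^sub>0 u\<^sub>2\<close> along the fibre, the differential of the superpotential vanishes
  exactly if \<open>b F b\<^sup>-\<^sup>1 = F\<close> for the subdiagonal shift \<open>F\<close>: a critical point is a lower
  triangular Toeplitz matrix. In ideal coordinates \<open>b = L\<^sub>1 \<dots> L\<^sub>n\<^sub>-\<^sub>1 t\<^sub>R\<close>, where \<open>L\<^sub>i\<close> is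
  unipotent and bidiagonal with entries \<open>a\<^sub>i\<^sub>j = 1 / m\<^sub>i\<^sub>j\<close>. Constancy on the main diagonal makes
  \<open>t\<^sub>R\<close> scalar, which gives the weight condition. The columns of the partial products
  \<open>L\<^sub>1 \<dots> L\<^sub>s\<close> are Pade numerators of the generating series of the Toeplitz matrix, and the
  Frobenius identities of the Pade table become
  \<open>(\<Prod>i\<le>s. a\<^sub>i\<^sub>J / a\<^sub>i\<^sub>,\<^sub>J\<^sub>+\<^sub>1) + (\<Prod>j>J. a\<^sub>s\<^sub>+\<^sub>1\<^sub>,\<^sub>j / a\<^sub>s\<^sub>j) = 1\<close>. Both summands are positive, so the
  smaller of their valuations is 0, and a purely tropical argument turns this into the ideal
  condition. Together with dominance the ideal condition forces the filling to be non-negative.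
\<close>

section \<open>Bidiagonal factors of a Toeplitz matrix\<close>

text \<open>
  With \<open>b s k\<close> the parameter \<open>a\<^sub>s\<^sub>,\<^sub>n\<^sub>-\<^sub>k\<close> of the factor \<open>L\<^sub>s\<close>, the polynomial \<open>factor_poly b s k\<close> lists the
  entries, from the diagonal downwards, of the column number \<open>n - s - k\<close> of \<open>L\<^sub>1 \<dots> L\<^sub>s\<close>.
\<close>

fun factor_poly :: "(nat \<Rightarrow> nat \<Rightarrow> 'a::comm_ring_1) \<Rightarrow> nat \<Rightarrow> nat \<Rightarrow> 'a poly" where
  "factor_poly b 0 k = 1"
| "factor_poly b (Suc s) k = factor_poly b s (Suc k) + pCons 0 (smult (b (Suc s) k) (factor_poly b s k))"

lemma degree_factor_poly: "degree (factor_poly b s k) \<le> s"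
proof (induction s arbitrary: k)
  case (Suc s)
  have "degree (pCons 0 (smult (b (Suc s) k) (factor_poly b s k))) \<le> Suc s"
    using Suc[of k] degree_smult_le[of "b (Suc s) k" "factor_poly b s k"]
    by (simp add: degree_pCons_le le_trans[OF degree_pCons_le])
  then show ?case using Suc[of "Suc k"] by (simp add: degree_add_le)
qed simp

lemma coeff_factor_poly_0: "coeff (factor_poly b s k) 0 = 1"
  by (induction s arbitrary: k) simp_all

lemma coeff_factor_poly_top: "coeff (factor_poly b s k) s = (\<Prod>i=1..s. b i k)"
proof (induction s arbitrary: k)
  case (Suc s)
  have "coeff (factor_poly b s (Suc k)) (Suc s) = 0"
    using degree_factor_poly[of b s "Suc k"] by (simp add: coeff_eq_0)
  then show ?case using Suc by (simp add: mult.commute)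
qed simp

text \<open>Comparison of coefficients in degree \<open>Suc s\<close>: the subtracted polynomial has
  degree at most \<open>s\<close>, so only leading coefficients survive. This ties the multiplier
  \<open>g\<close> to products of the parameters.\<close>

lemma factor_poly_diff_top:
  assumes "factor_poly b (Suc s) (Suc k) - factor_poly b s (Suc k) = smult g (pCons 0 (factor_poly b s k))"
  shows "g * (\<Prod>i=1..s. b i k) = (\<Prod>i=1..Suc s. b i (Suc k))"
proof -
  have "coeff (factor_poly b (Suc s) (Suc k) - factor_poly b s (Suc k)) (Suc s) = g * (\<Prod>i=1..s. b i k)"
    unfolding assms by (simp add: coeff_factor_poly_top)
  moreover have "coeff (factor_poly b s (Suc k)) (Suc s) = 0"
    using degree_factor_poly[of b s "Suc k"] by (simp add: coeff_eq_0)
  ultimately show ?thesis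
    using coeff_factor_poly_top[of b "Suc s" "Suc k"] by (simp del: factor_poly.simps)
qed

text \<open>The multiplier of the three-term relation in \<open>factor_poly_diff\<close>. The
  recursion is an additive rhombus rule as in the quotient-difference algorithm. The value 0 at
  \<open>k = 0\<close> is chosen so that
  \<open>factor_ratio b s 1 = b s 0 - b (Suc s) 0\<close>.\<close>

fun factor_ratio :: "(nat \<Rightarrow> nat \<Rightarrow> 'a::comm_ring_1) \<Rightarrow> nat \<Rightarrow> nat \<Rightarrow> 'a" where
  "factor_ratio b s 0 = 0"
| "factor_ratio b s (Suc k) = factor_ratio b (Suc s) k - b (Suc s) k + b s k"

lemma pCons_0_add: "pCons 0 (p + q) = pCons 0 p + pCons (0::'a::comm_monoid_add) q"
  by simp

lemma pCons_0_diff: "pCons 0 (p - q) = pCons 0 p - pCons (0::'a::ab_group_add) q"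
  by simp

text \<open>By \<open>toep\<close> the polynomials with \<open>k = 0\<close> are successive
  truncations of one power series. The defining recursion carries this from level \<open>k\<close>
  to level \<open>Suc k\<close>, in the form of a Frobenius identity between neighbouring Pade
  numerators.\<close>

lemma factor_poly_diff:
  fixes b :: "nat \<Rightarrow> nat \<Rightarrow> 'a::field"
  assumes nz: "\<And>s k. 1 \<le> s \<Longrightarrow> s + k < n \<Longrightarrow> b s k \<noteq> 0"
    and toep: "\<And>s. Suc s < n \<Longrightarrow> \<exists>x. factor_poly b (Suc s) 0 - factor_poly b s 0 = monom x (Suc s)"
    and "s + 2 + k < n"
  shows "factor_poly b (Suc s) (Suc k) - factor_poly b s (Suc k)
    = smult (factor_ratio b (Suc s) (Suc k)) (pCons 0 (factor_poly b s k))"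
  using \<open>s + 2 + k < n\<close>
proof (induction k arbitrary: s)
  \<comment> \<open>The unknown monomial is the leading term of
    \<open>factor_poly b (Suc s) 0\<close>, because \<open>factor_poly b s 0\<close> has degree at
    most \<open>s\<close>.\<close>
  have top: "factor_poly b (Suc s) 0 - factor_poly b s 0 = monom (\<Prod>i=1..Suc s. b i 0) (Suc s)"
    if s: "Suc s < n" for s
  proof -
    obtain x where x: "factor_poly b (Suc s) 0 - factor_poly b s 0 = monom x (Suc s)" using toep[OF s] by blast
    have "coeff (factor_poly b (Suc s) 0 - factor_poly b s 0) (Suc s) = (\<Prod>i=1..Suc s. b i 0)"
      using degree_factor_poly[of b s 0] coeff_factor_poly_top[of b "Suc s" 0]
      by (simp add: coeff_eq_0 del: factor_poly.simps)
    then show ?thesis unfolding x by simp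
  qed
  case 0
  let ?V = "\<Prod>i=1..Suc s. b i 0"
  have 1: "factor_poly b (Suc s) 0 = factor_poly b s 0 + monom ?V (Suc s)"
    using top[of s] 0 by (simp add: algebra_simps)
  have 2: "factor_poly b (Suc (Suc s)) 0
      = factor_poly b (Suc s) 0 + pCons 0 (smult (b (Suc (Suc s)) 0) (monom ?V (Suc s)))"
    using top[of "Suc s"] 0
    by (simp add: algebra_simps monom_Suc smult_monom del: factor_poly.simps)
  have 3: "factor_poly b (Suc (Suc s)) 0
      = factor_poly b (Suc s) (Suc 0) + pCons 0 (smult (b (Suc (Suc s)) 0) (factor_poly b (Suc s) 0))"
    by (rule factor_poly.simps)
  have 4: "factor_poly b (Suc s) 0 = factor_poly b s (Suc 0) + pCons 0 (smult (b (Suc s) 0) (factor_poly b s 0))"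
    by (rule factor_poly.simps)
  \<comment> \<open>The two expansions of \<open>factor_poly b (Suc (Suc s)) 0\<close> contain the
    same top monomial, which cancels.\<close>
  have "factor_poly b (Suc s) (Suc 0) = factor_poly b (Suc s) 0
      - pCons 0 (smult (b (Suc (Suc s)) 0) (factor_poly b s 0))"
    using 2 3 unfolding 1
    by (simp add: smult_add_right pCons_0_add algebra_simps del: factor_poly.simps add_pCons)
  then show ?case using 4
    by (simp add: algebra_simps smult_diff_left pCons_0_diff del: factor_poly.simps diff_pCons)
next
  case (Suc k)
  let ?V = "\<lambda>s k. \<Prod>i=1..s. b i k"
  have g: "factor_ratio b (Suc s) (Suc k) * ?V s k = ?V (Suc s) (Suc k)" if "s + 2 + k < n" for s
    by (rule factor_poly_diff_top[OF Suc.IH[OF that]])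
  have Vnz: "?V s k \<noteq> 0" using Suc.prems nz by auto
  let ?g1 = "factor_ratio b (Suc (Suc s)) (Suc k)" and ?g = "factor_ratio b (Suc s) (Suc k)"
  \<comment> \<open>The multiplicative rhombus rule, from the leading coefficients at
    \<open>s\<close> and \<open>Suc s\<close>. It cancels the terms shifted twice in the computation
    below.\<close>
  have "?g1 * b (Suc s) k * ?V s k = b (Suc (Suc s)) (Suc k) * ?g * ?V s k"
    using g[of s] g[of "Suc s"] Suc.prems by (simp add: algebra_simps del: factor_ratio.simps)
  then have c: "?g1 * b (Suc s) k = b (Suc (Suc s)) (Suc k) * ?g" using Vnz by simp
  have 1: "factor_poly b (Suc (Suc s)) (Suc k) - factor_poly b (Suc s) (Suc k)
      = smult ?g1 (pCons 0 (factor_poly b (Suc s) k))"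
    by (rule Suc.IH) (use Suc.prems in simp)
  have 2: "factor_poly b (Suc s) (Suc k) = factor_poly b s (Suc k) + smult ?g (pCons 0 (factor_poly b s k))"
    using Suc.IH[of s] Suc.prems by (simp add: algebra_simps del: factor_poly.simps factor_ratio.simps)
  have 3: "factor_poly b (Suc s) k = factor_poly b s (Suc k) + pCons 0 (smult (b (Suc s) k) (factor_poly b s k))"
    by (rule factor_poly.simps)
  have 4: "factor_poly b (Suc (Suc s)) (Suc k) = factor_poly b (Suc s) (Suc (Suc k))
      + pCons 0 (smult (b (Suc (Suc s)) (Suc k)) (factor_poly b (Suc s) (Suc k)))"
    by (rule factor_poly.simps)
  have 5: "factor_poly b (Suc s) (Suc k) = factor_poly b s (Suc (Suc k))
      + pCons 0 (smult (b (Suc s) (Suc k)) (factor_poly b s (Suc k)))"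
    by (rule factor_poly.simps)
  have "factor_poly b (Suc s) (Suc (Suc k)) - factor_poly b s (Suc (Suc k))
    = (factor_poly b (Suc (Suc s)) (Suc k) - factor_poly b (Suc s) (Suc k))
      - pCons 0 (smult (b (Suc (Suc s)) (Suc k)) (factor_poly b (Suc s) (Suc k)))
      + pCons 0 (smult (b (Suc s) (Suc k)) (factor_poly b s (Suc k)))"
    using 4 5 by (simp add: algebra_simps del: factor_poly.simps factor_ratio.simps)
  also have "\<dots> = smult ?g1 (pCons 0 (factor_poly b s (Suc k) + pCons 0 (smult (b (Suc s) k) (factor_poly b s k))))
      - pCons 0 (smult (b (Suc (Suc s)) (Suc k)) (factor_poly b s (Suc k) + smult ?g (pCons 0 (factor_poly b s k))))
      + pCons 0 (smult (b (Suc s) (Suc k)) (factor_poly b s (Suc k)))"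
    unfolding 1 unfolding 3 unfolding 2 ..
  also have "\<dots> = smult (factor_ratio b (Suc s) (Suc (Suc k))) (pCons 0 (factor_poly b s (Suc k)))"
    using c by (simp add: algebra_simps smult_add_right smult_add_left smult_diff_left
        factor_ratio.simps(2)[of b "Suc s" "Suc k"] del: factor_poly.simps factor_ratio.simps)
  finally show ?case .
qed

text \<open>Both summands come from \<open>factor_ratio b (Suc s) (Suc k) / b (Suc s) k\<close>.
  Leading coefficients show that it is the first product; by the two rhombus rules its complement to
  1 is the second one, built up factor by factor in \<open>k\<close>.\<close>

lemma toeplitz_factor_relation:
  fixes b :: "nat \<Rightarrow> nat \<Rightarrow> 'a::field"
  assumes nz: "\<And>s k. 1 \<le> s \<Longrightarrow> s + k < n \<Longrightarrow> b s k \<noteq> 0"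
    and toep: "\<And>s. Suc s < n \<Longrightarrow> \<exists>x. factor_poly b (Suc s) 0 - factor_poly b s 0 = monom x (Suc s)"
    and k: "Suc s + Suc k < n"
  shows "(\<Prod>i=1..Suc s. b i (Suc k) / b i k) + (\<Prod>j\<le>k. b (Suc (Suc s)) j / b (Suc s) j) = 1"
proof -
  let ?V = "\<lambda>s k. \<Prod>i=1..s. b i k"
  have g: "factor_ratio b (Suc s) (Suc k) * ?V s k = ?V (Suc s) (Suc k)" if "s + 2 + k < n" for s k
    by (rule factor_poly_diff_top, rule factor_poly_diff[where n = n]) (use nz toep that in auto)
  have Vnz: "?V s k \<noteq> 0" if "s + k < n" for s k using that nz by auto
  have "1 - factor_ratio b (Suc s) (Suc k) / b (Suc s) k = (\<Prod>j\<le>k. b (Suc (Suc s)) j / b (Suc s) j)"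
    using k
  proof (induction k)
    case 0
    then show ?case using nz[of "Suc s" 0] by (simp add: field_simps)
  next
    case (Suc k)
    let ?g = "factor_ratio b (Suc s) (Suc k)" and ?g1 = "factor_ratio b (Suc (Suc s)) (Suc k)"
    have nz1: "b (Suc s) k \<noteq> 0" "b (Suc s) (Suc k) \<noteq> 0" using nz Suc.prems by auto
    have "?g1 * b (Suc s) k * ?V s k = b (Suc (Suc s)) (Suc k) * ?g * ?V s k"
      using g[of s k] g[of "Suc s" k] Suc.prems by (simp add: algebra_simps del: factor_ratio.simps)
    then have "?g1 * b (Suc s) k = b (Suc (Suc s)) (Suc k) * ?g"
      using Vnz[of s k] Suc.prems by simp
    then have g1: "?g1 = b (Suc (Suc s)) (Suc k) * (?g / b (Suc s) k)"
      using nz1 by (simp add: field_simps del: factor_ratio.simps)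
    have "1 - factor_ratio b (Suc s) (Suc (Suc k)) / b (Suc s) (Suc k)
        = (b (Suc (Suc s)) (Suc k) - ?g1) / b (Suc s) (Suc k)"
      unfolding factor_ratio.simps(2)[of b "Suc s" "Suc k"]
      using nz1 by (simp add: field_simps del: factor_ratio.simps)
    also have "\<dots> = (1 - ?g / b (Suc s) k) * (b (Suc (Suc s)) (Suc k) / b (Suc s) (Suc k))"
      unfolding g1 by (simp add: algebra_simps diff_divide_distrib del: factor_ratio.simps)
    finally show ?case using Suc by (simp del: factor_ratio.simps)
  qed
  moreover have "factor_ratio b (Suc s) (Suc k) / b (Suc s) k = (\<Prod>i=1..Suc s. b i (Suc k) / b i k)"
  proof -
    have "factor_ratio b (Suc s) (Suc k) = ?V (Suc s) (Suc k) / ?V s k"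
      using g[of s k] Vnz[of s k] k by (simp add: field_simps del: factor_ratio.simps)
    then show ?thesis by (simp add: prod_dividef del: factor_ratio.simps)
  qed
  ultimately show ?thesis by (simp add: algebra_simps del: factor_ratio.simps)
qed

section \<open>Tropical consequences\<close>

text \<open>With \<open>A i j\<close> the valuation of the parameter \<open>a i j\<close>,
  \<open>p\<close> and \<open>q\<close> are the valuations of the two products that add up to 1.
  Passing to a neighbouring \<open>p\<close> or \<open>q\<close> changes it by a difference of
  adjacent entries of \<open>A\<close>, and the sign of that difference is known wherever one of the
  neighbours vanishes.\<close>

lemma tropical_ideal:
  fixes A :: "nat \<Rightarrow> nat \<Rightarrow> real" and n :: nat
  defines "p \<equiv> \<lambda>s J. \<Sum>i=1..s. A i J - A i (Suc J)"
    and "q \<equiv> \<lambda>s J. \<Sum>j=Suc J..n. A (Suc s) j - A s j"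
  assumes pq: "\<And>s J. 1 \<le> s \<Longrightarrow> s < J \<Longrightarrow> J < n \<Longrightarrow> min (p s J) (q s J) = 0"
    and "1 \<le> s" "s < J" "J < n"
  shows "A s (Suc J) = min (A s J) (A (Suc s) (Suc J))"
proof -
  have pS: "p (Suc s) J = p s J + (A (Suc s) J - A (Suc s) (Suc J))" for s J
    by (simp add: p_def)
  have p0: "p 0 J = 0" for J by (simp add: p_def)
  have qS: "q s J = q s (Suc J) + (A (Suc s) (Suc J) - A s (Suc J))" if "J < n" for s J
    using that by (simp add: q_def sum.atLeast_Suc_atMost)
  have qn: "q s n = 0" for s by (simp add: q_def)
  have pge: "p s J \<ge> 0" if "s < J" "J < n" for s J
    using pq[of s J] that p0[of J] by (cases "s = 0") auto
  have qge: "q s J \<ge> 0" if "1 \<le> s" "s < J" "J \<le> n" for s J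
    using pq[of s J] that qn[of s] by (cases "J = n") auto
  \<comment> \<open>The two inequalities support each other: each one for \<open>(s, J)\<close> follows from those with a
    smaller value of \<open>s - J\<close>.\<close>
  have mono: "(\<forall>s J. 1 \<le> s \<longrightarrow> s < J \<longrightarrow> J < n \<longrightarrow> n + s = J + d \<longrightarrow>
      A s (Suc J) \<le> A s J \<and> A s (Suc J) \<le> A (Suc s) (Suc J))" for d
  proof (induction d)
    case (Suc d)
    show ?case
    proof (intro allI impI)
      fix s J assume sJ: "1 \<le> s" "s < J" "J < n" "n + s = J + Suc d"
      have IH: "A s' (Suc J') \<le> A s' J' \<and> A s' (Suc J') \<le> A (Suc s') (Suc J')"
        if "1 \<le> s'" "s' < J'" "J' < n" "n + s' = J' + d" for s' J'
        using Suc.IH that by blast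
      have "A s (Suc J) \<le> A (Suc s) (Suc J)"
      proof (cases "q s (Suc J) = 0")
        case True
        then show ?thesis using qge[of s J] qS[of J s] sJ by simp
      next
        case False
        then have J: "Suc J < n" using qn[of s] sJ by (cases "Suc J = n") auto
        \<comment> \<open>The vanishing \<open>p s (Suc J)\<close> is a sum of two terms that turn
          out to be non-negative, so row \<open>s\<close> takes equal values in columns
          \<open>Suc J\<close> and \<open>Suc (Suc J)\<close>. The inequality then follows from the
          one for \<open>Suc J\<close>.\<close>
        have ps: "p s (Suc J) = 0" using pq[of s "Suc J"] False sJ J by (auto simp: min_def split: if_splits)
        obtain s' where s': "s = Suc s'" using sJ(1) by (cases s) auto
        have ih: "A s (Suc (Suc J)) \<le> A s (Suc J)" "A s (Suc (Suc J)) \<le> A (Suc s) (Suc (Suc J))"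
          using IH[of s "Suc J"] sJ J by auto
        have "p s' (Suc J) \<ge> 0" using pge[of s' "Suc J"] sJ J s' by simp
        then have "A s (Suc J) = A s (Suc (Suc J))" using ps pS[of s' "Suc J"] ih s' by simp
        moreover have "A (Suc s) (Suc J) \<ge> A (Suc s) (Suc (Suc J))"
          using pge[of "Suc s" "Suc J"] pS[of s "Suc J"] ps sJ J by simp
        ultimately show ?thesis using ih by simp
      qed
      moreover have "A s (Suc J) \<le> A s J"
      proof -
        obtain s' where s': "s = Suc s'" using sJ(1) by (cases s) auto
        obtain J' where J': "J = Suc J'" using sJ(2) by (cases J) auto
        show ?thesis
        proof (cases "p s' J = 0")
          case True
          then show ?thesis using pge[of s J] pS[of s' J] sJ s' by simp
        next
          case False
          then have s1: "1 \<le> s'" using p0[of J] by (cases s') auto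
          have qs: "q s' J = 0" using pq[of s' J] False sJ s1 s' by (auto simp: min_def split: if_splits)
          have ih: "A s' (Suc J) \<le> A s' J" "A s' (Suc J) \<le> A s (Suc J)"
            using IH[of s' J] sJ s' s1 by auto
          have "q s' (Suc J) \<ge> 0" using qge[of s' "Suc J"] sJ s1 s' by simp
          then have "A s (Suc J) = A s' (Suc J)" using qs qS[of J s'] ih s' sJ by simp
          moreover have "A s J \<ge> A s' J"
            using qge[of s' J'] qS[of J' s'] qs sJ s1 s' J' by simp
          ultimately show ?thesis using ih by simp
        qed
      qed
      ultimately show "A s (Suc J) \<le> A s J \<and> A s (Suc J) \<le> A (Suc s) (Suc J)" by simp
    qed
  qed auto
  have le: "A s (Suc J) \<le> A s J" "A s (Suc J) \<le> A (Suc s) (Suc J)"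
    using mono[of "n + s - J"] assms(4-6) by auto
  obtain s' where s': "s = Suc s'" using assms(4) by (cases s) auto
  \<comment> \<open>By \<open>le\<close> each of \<open>p s J\<close> and \<open>q s J\<close> is a
    sum of two non-negative terms, so whichever vanishes turns one of the two inequalities into an
    equality.\<close>
  have "p s J = 0 \<or> q s J = 0" using pq[of s J] assms(4-6) by (auto simp: min_def split: if_splits)
  then have "A s (Suc J) = A s J \<or> A s (Suc J) = A (Suc s) (Suc J)"
    using pS[of s' J] qS[of J s] pge[of s' J] qge[of s "Suc J"] le s' assms(4-6) by auto
  then show ?thesis using le by auto
qed

text \<open>No entry of an ideal array lies below its smallest entry \<open>f r (Suc r)\<close> next
  to the diagonal, so only the sign of that one matters. The hypothesis \<open>dom\<close> is
  dominance of the weight, with the common constant of both sides removed.\<close>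

lemma ideal_nonneg:
  fixes f :: "nat \<Rightarrow> nat \<Rightarrow> real"
  assumes ideal: "\<And>i j. 1 \<le> i \<Longrightarrow> j \<le> n \<Longrightarrow> i + 2 \<le> j \<Longrightarrow> f i j = max (f (i + 1) j) (f i (j - 1))"
    and dom: "\<And>j. 1 \<le> j \<Longrightarrow> j < n \<Longrightarrow>
      (\<Sum>l=j+2..n. f (j + 1) l) - (\<Sum>k=1..j. f k (j + 1)) \<le> (\<Sum>l=j+1..n. f j l) - (\<Sum>k=1..<j. f k j)"
    and ij: "1 \<le> i" "i < j" "j \<le> n"
  shows "0 \<le> f i j"
proof -
  define r where "r = arg_min_on (\<lambda>r. f r (Suc r)) {1..<n}"
  have ne: "finite {1..<n}" "{1..<n} \<noteq> {}" using ij by auto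
  have r: "1 \<le> r" "r < n" using arg_min_if_finite(1)[OF ne, of "\<lambda>r. f r (Suc r)"] unfolding r_def by auto
  have rmin: "f r (Suc r) \<le> f k (Suc k)" if "1 \<le> k" "k < n" for k
    using arg_min_least[OF ne, of k "\<lambda>r. f r (Suc r)"] that unfolding r_def by auto
  have lb: "f r (Suc r) \<le> f i j" if "1 \<le> i" "i < j" "j \<le> n" for i j
    using that
  proof (induction "j - i" arbitrary: i j)
    case (Suc d)
    show ?case
    proof (cases "j = Suc i")
      case False
      then have "f r (Suc r) \<le> f (i + 1) j"
        using Suc.hyps(2) Suc.prems by (intro Suc.hyps(1)) auto
      then show ?thesis using False ideal[of i j] Suc.prems by (simp add: max.coboundedI1)
    qed (use Suc.prems rmin in auto)
  qed simp
  \<comment> \<open>By minimality of \<open>f r (r + 1)\<close> everything cancels in the dominance inequality at \<open>r\<close>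
    except \<open>2 * f r (r + 1)\<close>.\<close>
  have e1: "f r l = f (r + 1) l" if "r + 2 \<le> l" "l \<le> n" for l
    using that
  proof (induction l rule: dec_induct)
    case base
    then show ?case using ideal[of r "r + 2"] r lb[of "r+1" "r+2"] by (simp add: max_def)
  next
    case (step l)
    then show ?case using ideal[of r "Suc l"] ideal[of "r + 1" "Suc l"] r lb[of "r + 1" "Suc l"]
      by (cases "l = r + 2") (auto simp: max_def)
  qed
  have e2: "f k (r + 1) = f k r" if "1 \<le> k" "k < r" for k
  proof -
    have "k \<le> r - 1" using that by simp
    then show ?thesis using that(1)
    proof (induction rule: inc_induct)
      case base
      then show ?case using ideal[of "r - 1" "r + 1"] r lb[of "r - 1" r] that
        by (simp add: max_def)
    next
      case (step k)
      then show ?case using ideal[of k "r + 1"] ideal[of k r] r lb[of k r]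
        by (cases "Suc k = r - 1") (auto simp: max_def)
    qed
  qed
  have "(\<Sum>l=r+1..n. f r l) = f r (Suc r) + (\<Sum>l=r+2..n. f (r + 1) l)"
    using r e1 by (subst sum.atLeast_Suc_atMost) auto
  moreover have "(\<Sum>k=1..r. f k (r + 1)) = f r (Suc r) + (\<Sum>k=1..<r. f k r)"
  proof -
    have "{1..r} = insert r {1..<r}" using r by auto
    then show ?thesis using e2 by simp
  qed
  ultimately have "0 \<le> f r (Suc r)" using dom[of r] r by simp
  then show ?thesis using lb ij by fastforce
qed

section \<open>Bruhat decomposition over a commutative ring\<close>

lemma index_mult_mat_sum:
  assumes "A \<in> carrier_mat n k" "B \<in> carrier_mat k l" "i < n" "j < l"
  shows "(A * B) $$ (i, j) = (\<Sum>r<k. A $$ (i, r) * B $$ (r, j))"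
  using assms by (simp add: scalar_prod_def lessThan_atLeast0)

lemma upper_triangular_mult:
  fixes A B :: "'a::comm_ring_1 mat"
  assumes A: "A \<in> carrier_mat n n" "upper_triangular A" and B: "B \<in> carrier_mat n n" "upper_triangular B"
  shows "upper_triangular (A * B)" and "i < n \<Longrightarrow> (A * B) $$ (i, i) = A $$ (i, i) * B $$ (i, i)"
proof -
  have z: "A $$ (i, r) * B $$ (r, j) = 0" if "i < n" "r < n" "r < i \<or> j < r" for i r j
    using that A B by (auto simp: upper_triangular_def)
  show "upper_triangular (A * B)"
  proof (rule upper_triangularI)
    fix i j assume "j < i" "i < dim_row (A * B)"
    then have ij: "j < i" "i < n" using A(1) by auto
    have "A $$ (i, r) * B $$ (r, j) = 0" if "r < n" for r
      using z[of i r j] ij that by (cases "r < i") auto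
    then show "(A * B) $$ (i, j) = 0"
      using ij index_mult_mat_sum[OF A(1) B(1), of i j] by simp
  qed
  show "(A * B) $$ (i, i) = A $$ (i, i) * B $$ (i, i)" if i: "i < n"
  proof -
    have "(\<Sum>r<n. A $$ (i, r) * B $$ (r, i)) = (\<Sum>r\<in>{i}. A $$ (i, r) * B $$ (r, i))"
      using z[of i _ i] i by (intro sum.mono_neutral_right) (auto, metis linorder_neqE_nat)
    then show ?thesis using i index_mult_mat_sum[OF A(1) B(1), of i i] by simp
  qed
qed

text \<open>Back substitution from the last row clears \<open>B\<close> below the diagonal. The dual
  numbers have zero divisors, so the diagonal entries of \<open>A\<close> must be known to be units,
  not merely non-zero.\<close>

lemma upper_triangular_inverse:
  fixes A B :: "'a::comm_ring_1 mat"
  assumes A: "A \<in> carrier_mat n n" "upper_triangular A" and B: "B \<in> carrier_mat n n"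
    and BA: "B * A = 1\<^sub>m n" and AB: "A * B = 1\<^sub>m n"
  shows "upper_triangular B" and "i < n \<Longrightarrow> A $$ (i, i) * B $$ (i, i) = 1"
proof -
  \<comment> \<open>The product of the diagonal entries of \<open>A\<close> is its determinant, a unit.\<close>
  have unit: "\<exists>c. A $$ (i, i) * c = 1" if i: "i < n" for i
  proof -
    have "det A * det B = 1" using det_mult[OF A(1) B] AB by simp
    moreover have "det A = (\<Prod>i=0..<n. A $$ (i, i))"
      using det_upper_triangular[OF A(2,1)] A(1) by (simp add: prod_list_diag_prod)
    moreover have "(\<Prod>i=0..<n. A $$ (i, i)) = A $$ (i, i) * (\<Prod>i\<in>{0..<n} - {i}. A $$ (i, i))"
      using i by (intro prod.remove) auto
    ultimately have "A $$ (i, i) * ((\<Prod>i\<in>{0..<n} - {i}. A $$ (i, i)) * det B) = 1"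
      by (simp add: mult.assoc)
    then show ?thesis by blast
  qed
  have zero: "B $$ (i, j) = 0" if "j < i" "i < n" for i j
    using that
  proof (induction "n - i" arbitrary: i rule: less_induct)
    case less
    have "A $$ (i, r) * B $$ (r, j) = 0" if "r < n" "r \<noteq> i" for r
      using less that A by (cases "r < i") (auto simp: upper_triangular_def)
    then have "(\<Sum>r<n. A $$ (i, r) * B $$ (r, j)) = (\<Sum>r\<in>{i}. A $$ (i, r) * B $$ (r, j))"
      using less.prems by (intro sum.mono_neutral_right) auto
    then have e: "A $$ (i, i) * B $$ (i, j) = 0"
      using less.prems index_mult_mat_sum[OF A(1) B, of i j] AB by simp
    obtain c where "A $$ (i, i) * c = 1" using unit less.prems by blast
    then have "B $$ (i, j) = A $$ (i, i) * c * B $$ (i, j)" by simp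
    also have "\<dots> = (A $$ (i, i) * B $$ (i, j)) * c" by (simp only: ac_simps)
    finally show ?case using e by simp
  qed
  show upB: "upper_triangular B" using zero B by (intro upper_triangularI) auto
  show "A $$ (i, i) * B $$ (i, i) = 1" if "i < n"
    using upper_triangular_mult(2)[OF A B upB that] AB that by simp
qed

lemma GL_iff: "A \<in> GL n \<longleftrightarrow>
  A \<in> carrier_mat n n \<and> (\<exists>B\<in>carrier_mat n n. A * B = 1\<^sub>m n \<and> B * A = 1\<^sub>m n)"
proof
  assume "A \<in> GL n"
  then obtain B where A: "A \<in> carrier_mat n n" and B: "A * B = 1\<^sub>m n" "B * A = 1\<^sub>m (dim_row B)"
    unfolding GL_def invertible_mat_def inverts_mat_def by auto
  have "dim_col B = n" using B(1) by (metis index_mult_mat(3) index_one_mat(3))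
  moreover have "dim_row B = n"
    using B(2) A by (metis carrier_matD(2) index_mult_mat(3) index_one_mat(3))
  ultimately show "A \<in> carrier_mat n n \<and> (\<exists>B\<in>carrier_mat n n. A * B = 1\<^sub>m n \<and> B * A = 1\<^sub>m n)"
    using A B by (auto intro!: bexI[of _ B])
qed (auto simp: GL_def invertible_mat_def inverts_mat_def)

lemma GL_mult:
  assumes "A \<in> GL n" "B \<in> GL n"
  shows "A * B \<in> GL n"
proof -
  obtain A' B' where c: "A \<in> carrier_mat n n" "A' \<in> carrier_mat n n" "B \<in> carrier_mat n n" "B' \<in> carrier_mat n n"
    and e: "A * A' = 1\<^sub>m n" "A' * A = 1\<^sub>m n" "B * B' = 1\<^sub>m n" "B' * B = 1\<^sub>m n"
    using assms unfolding GL_iff by blast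
  have "A * B * (B' * A') = A * (B * B') * A'" "B' * A' * (A * B) = B' * (A' * A) * B"
    using c by (simp_all add: assoc_mult_mat[of _ n n _ n _ n])
  then have "A * B * (B' * A') = 1\<^sub>m n" "B' * A' * (A * B) = 1\<^sub>m n" using c e by simp_all
  then show ?thesis unfolding GL_iff using c by (meson mult_carrier_mat)
qed

lemma borel_upper_mult: "A \<in> borel_upper n \<Longrightarrow> B \<in> borel_upper n \<Longrightarrow> A * B \<in> borel_upper n"
  using upper_triangular_mult(1)[of A n B] GL_mult[of A n B] by (auto simp: borel_upper_def GL_def)

text \<open>The determinant is 1, so the adjugate is an inverse over any commutative ring.
  Membership can therefore be checked on the entries alone.\<close>

lemma unipotent_upper_iff: "u \<in> unipotent_upper n \<longleftrightarrow>
  u \<in> carrier_mat n n \<and> upper_triangular u \<and> (\<forall>i<n. u $$ (i, i) = 1)"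
proof
  assume u: "u \<in> carrier_mat n n \<and> upper_triangular u \<and> (\<forall>i<n. u $$ (i, i) = 1)"
  then have "det u = 1"
    using det_upper_triangular[of u n] by (auto simp: prod_list_diag_prod)
  then have "u * adj_mat u = 1\<^sub>m n" "adj_mat u * u = 1\<^sub>m n" "adj_mat u \<in> carrier_mat n n"
    using adj_mat[of u n] u by auto
  then show "u \<in> unipotent_upper n"
    using u by (auto simp: unipotent_upper_def borel_upper_def GL_iff)
qed (auto simp: unipotent_upper_def borel_upper_def GL_def)

lemma unipotent_upper_mult:
  "u \<in> unipotent_upper n \<Longrightarrow> v \<in> unipotent_upper n \<Longrightarrow> u * v \<in> unipotent_upper n"
  using upper_triangular_mult[of u n v] by (auto simp: unipotent_upper_iff)

lemma unipotent_upper_inverse: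
  fixes u :: "'a::comm_ring_1 mat"
  assumes "u \<in> unipotent_upper n"
  obtains v where "v \<in> unipotent_upper n" "u * v = 1\<^sub>m n" "v * u = 1\<^sub>m n"
proof -
  have "u \<in> GL n" using assms by (simp add: unipotent_upper_def borel_upper_def)
  then obtain v where v: "v \<in> carrier_mat n n" "u * v = 1\<^sub>m n" "v * u = 1\<^sub>m n" unfolding GL_iff by blast
  have u: "u \<in> carrier_mat n n" "upper_triangular u" "\<forall>i<n. u $$ (i, i) = 1"
    using assms by (auto simp: unipotent_upper_iff)
  have "v \<in> unipotent_upper n"
    unfolding unipotent_upper_iff using upper_triangular_inverse[OF u(1,2) v(1,3,2)] u(3) v(1) by auto
  then show thesis using that v by blast
qed

lemma mat_diag_torus:
  assumes "\<And>i. i < n \<Longrightarrow> f i * g i = (1::'a::comm_ring_1)"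
  shows "mat_diag n f \<in> torus n"
proof -
  have "mat_diag n f * mat_diag n g = 1\<^sub>m n" "mat_diag n g * mat_diag n f = 1\<^sub>m n"
    unfolding mat_diag_diag using assms
    by (auto intro!: eq_matI simp: mat_diag_def mult.commute)
  then have "mat_diag n f \<in> GL n" unfolding GL_iff using mat_diag_dim by blast
  moreover have "diagonal_mat (mat_diag n f)" by (auto simp: diagonal_mat_def mat_diag_def)
  ultimately show ?thesis by (simp add: torus_def)
qed

lemma torusD:
  fixes d :: "'a::comm_ring_1 mat"
  assumes "d \<in> torus n"
  shows "d \<in> carrier_mat n n" "d = mat_diag n (\<lambda>i. d $$ (i, i))" "d \<in> borel_upper n"
    and "i < n \<Longrightarrow> \<exists>c. d $$ (i, i) * c = 1"
proof -
  have d: "d \<in> GL n" "diagonal_mat d" using assms by (auto simp: torus_def)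
  show c: "d \<in> carrier_mat n n" using d by (simp add: GL_def)
  have up: "upper_triangular d"
    using d(2) c by (auto simp: diagonal_mat_def intro!: upper_triangularI)
  then show "d \<in> borel_upper n" using d by (simp add: borel_upper_def)
  show "d = mat_diag n (\<lambda>i. d $$ (i, i))"
    using d(2) c by (auto intro!: eq_matI simp: mat_diag_def diagonal_mat_def)
  show "\<exists>c. d $$ (i, i) * c = 1" if "i < n"
    using d(1) upper_triangular_inverse(2)[OF c up _ _ _ that] unfolding GL_iff by blast
qed

section \<open>Signed permutation matrices and the representative of the longest element\<close>

text \<open>The product \<open>s\<^sub>1 s\<^sub>2 \<dots> s\<^sub>k\<close>, a signed cycle.\<close>

definition cyc_mat :: "nat \<Rightarrow> nat \<Rightarrow> 'a::comm_ring_1 mat" where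
  "cyc_mat n k = mat n n (\<lambda>(i, j).
     if j < k then (if i = Suc j then 1 else 0)
     else if j = k then (if i = 0 then (- 1) ^ k else 0)
     else if i = j then 1 else 0)"

lemma cyc_mat_carrier [simp]: "cyc_mat n k \<in> carrier_mat n n" by (simp add: cyc_mat_def)

lemmas cyc_mat_dim [simp] = carrier_matD[OF cyc_mat_carrier]

lemma phi_carrier [simp]: "phi n i M \<in> carrier_mat n n" by (simp add: phi_def)

lemmas phi_dim [simp] = carrier_matD[OF phi_carrier]

lemma s_bar_carrier [simp]: "s_bar n i \<in> carrier_mat n n" by (simp add: s_bar_def)

lemmas s_bar_dim [simp] = carrier_matD[OF s_bar_carrier]

lemma s_bar_index:
  "i < n \<Longrightarrow> j < n \<Longrightarrow> s_bar n (Suc k) $$ (i, j) =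
    (if i = Suc k \<and> j = k then 1 else if i = k \<and> j = Suc k then - 1
     else if i = j \<and> i \<noteq> k \<and> i \<noteq> Suc k then 1 else 0)"
  by (auto simp: s_bar_def phi_def mat_of_rows_list_def)

lemma y_mat_carrier [simp]: "y_mat n i z \<in> carrier_mat n n" by (simp add: y_mat_def)

lemmas y_mat_dim [simp] = carrier_matD[OF y_mat_carrier]

lemma y_mat_index:
  "i < n \<Longrightarrow> j < n \<Longrightarrow> y_mat n (Suc k) z $$ (i, j) =
    (if i = Suc k \<and> j = k then z else if i = j then 1 else 0)"
  by (auto simp: y_mat_def phi_def mat_of_rows_list_def)

lemma mat_product_Nil [simp]: "mat_product n [] = 1\<^sub>m n" by (simp add: mat_product_def)

lemma mat_product_Cons: "mat_product n (A # As) = A * mat_product n As" by (simp add: mat_product_def)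

lemma mat_product_carrier: "set As \<subseteq> carrier_mat n n \<Longrightarrow> mat_product n As \<in> carrier_mat n n"
  by (induction As) (auto simp: mat_product_Cons)

lemma mat_product_append:
  assumes "set As \<subseteq> carrier_mat n n" "set Bs \<subseteq> carrier_mat n n"
  shows "mat_product n (As @ Bs) = mat_product n As * mat_product n Bs"
  using assms(1)
proof (induction As)
  case Nil
  then show ?case using mat_product_carrier[OF assms(2)] by simp
next
  case (Cons A As)
  then show ?case
    using mat_product_carrier[OF assms(2)] mat_product_carrier[of As n]
    by (simp add: mat_product_Cons assoc_mult_mat[of _ n n _ n _ n])
qed

lemma mult_s_bar:
  assumes A: "A \<in> carrier_mat n n" and k: "Suc k < n"
  shows "A * s_bar n (Suc k) = mat n n (\<lambda>(i, j).
    if j = k then A $$ (i, Suc k) else if j = Suc k then - A $$ (i, k) else A $$ (i, j))"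
    (is "_ = ?R")
proof (rule eq_matI)
  fix i j assume "i < dim_row ?R" "j < dim_col ?R"
  then have ij: "i < n" "j < n" by auto
  let ?f = "\<lambda>r. A $$ (i, r) * s_bar n (Suc k) $$ (r, j)"
  let ?r = "if j = k then Suc k else if j = Suc k then k else j"
  have "(\<Sum>r<n. ?f r) = (\<Sum>r\<in>{?r}. ?f r)"
    using ij k by (intro sum.mono_neutral_right) (auto simp: s_bar_index)
  then show "(A * s_bar n (Suc k)) $$ (i, j) = ?R $$ (i, j)"
    using ij k index_mult_mat_sum[OF A s_bar_carrier, of i j] by (simp add: s_bar_index)
qed (use A in simp_all)

lemma s_bar_block: "k < n \<Longrightarrow> mat_product n (map (s_bar n) [1..<Suc k]) = (cyc_mat n k :: 'a::comm_ring_1 mat)"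
proof (induction k)
  case 0
  then show ?case by (auto intro!: eq_matI simp: cyc_mat_def)
next
  case (Suc k)
  have "[1..<Suc (Suc k)] = [1..<Suc k] @ [Suc k]" by simp
  then have "mat_product n (map (s_bar n) [1..<Suc (Suc k)]) = (cyc_mat n k * s_bar n (Suc k) :: 'a mat)"
    using Suc by (simp add: mat_product_append image_subset_iff mat_product_Cons del: upt_Suc)
  also have "\<dots> = cyc_mat n (Suc k)"
    using Suc.prems by (auto intro!: eq_matI simp: mult_s_bar cyc_mat_def)
  finally show ?case .
qed

lemma mult_cyc_mat:
  assumes B: "B \<in> carrier_mat n n" and k: "k < n"
  shows "cyc_mat n k * B = mat n n (\<lambda>(i, j).
    if i = 0 then (- 1) ^ k * B $$ (k, j) else if i \<le> k then B $$ (i - 1, j) else B $$ (i, j))"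
    (is "_ = ?R")
proof (rule eq_matI)
  fix i j assume "i < dim_row ?R" "j < dim_col ?R"
  then have ij: "i < n" "j < n" by auto
  let ?f = "\<lambda>r. cyc_mat n k $$ (i, r) * B $$ (r, j)"
  let ?r = "if i = 0 then k else if i \<le> k then i - 1 else i"
  have "(\<Sum>r<n. ?f r) = (\<Sum>r\<in>{?r}. ?f r)"
    using ij k by (intro sum.mono_neutral_right) (auto simp: cyc_mat_def)
  then show "(cyc_mat n k * B) $$ (i, j) = ?R $$ (i, j)"
    using ij k index_mult_mat_sum[OF cyc_mat_carrier B, of i j] by (auto simp: cyc_mat_def)
qed (use B in simp_all)

text \<open>The word is consumed block by block from its end: the last \<open>k\<close> blocks give
  the signed antidiagonal on the first \<open>k + 1\<close> coordinates, and the next block is a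
  signed cycle that pushes these rows down by one.\<close>

lemma w0_bar_eq:
  assumes "n \<ge> 1"
  shows "w0_bar n = (mat n n (\<lambda>(i, j). if i + j + 1 = n then (- 1) ^ j else 0) :: 'a::comm_ring_1 mat)"
proof -
  let ?blk = "\<lambda>k. map (s_bar n :: nat \<Rightarrow> 'a mat) [1..<Suc (n - k)]"
  have tail: "mat_product n (concat (map ?blk [n - k..<n])) = mat n n (\<lambda>(i, j).
      if j \<le> k then (if i + j = k then (- 1) ^ j else 0) else if i = j then 1 else 0 :: 'a)" (is "_ = ?M k")
    if "k < n" for k
    using that
  proof (induction k)
    case 0
    then show ?case by (auto intro!: eq_matI)
  next
    case (Suc k)
    have M: "?M k \<in> carrier_mat n n" by simp
    have "[n - Suc k..<n] = (n - Suc k) # [n - k..<n]"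
      using Suc.prems Suc_diff_Suc[of k n] upt_conv_Cons[of "n - Suc k" n] by simp
    then have "mat_product n (concat (map ?blk [n - Suc k..<n]))
        = mat_product n (?blk (n - Suc k)) * mat_product n (concat (map ?blk [n - k..<n]))"
      by (simp del: upt_Suc) (intro mat_product_append; auto)
    also have "\<dots> = cyc_mat n (Suc k) * ?M k"
      using Suc s_bar_block[of "Suc k" n, where 'a = 'a] by (simp del: upt_Suc)
    also have "\<dots> = ?M (Suc k)"
    proof (rule eq_matI)
      fix i j assume "i < dim_row (?M (Suc k))" "j < dim_col (?M (Suc k))"
      then have ij: "i < n" "j < n" by simp_all
      show "(cyc_mat n (Suc k) * ?M k) $$ (i, j) = ?M (Suc k) $$ (i, j)"
      proof (cases i)
        case 0
        then show ?thesis using ij Suc.prems by (simp add: mult_cyc_mat[OF M])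
      next
        case (Suc i')
        then show ?thesis using ij \<open>Suc k < n\<close>
          by (cases "i' \<le> k"; cases "j \<le> k"; cases "j = Suc k"; cases "i' = j"; cases "Suc i' = j")
            (simp_all add: mult_cyc_mat[OF M], (arith+)?)
      qed
    qed simp_all
    finally show ?case .
  qed
  have "(w0_bar n :: 'a mat) = mat_product n (concat (map ?blk [n - (n - 1)..<n]))"
    using assms by (simp add: w0_bar_def word_i0_def map_concat o_def del: upt_Suc)
  also have "\<dots> = ?M (n - 1)" using assms by (intro tail) simp
  also have "\<dots> = mat n n (\<lambda>(i, j). if i + j + 1 = n then (- 1) ^ j else 0)"
    by (auto intro!: eq_matI)
  finally show ?thesis .
qed

lemma w0_bar_carrier [simp]: "w0_bar n \<in> carrier_mat n n"
  unfolding w0_bar_def by (rule mat_product_carrier) auto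

lemma mult_w0_bar:
  assumes A: "A \<in> carrier_mat n n" and ij: "i < n" "j < n"
  shows "(A * w0_bar n) $$ (i, j) = A $$ (i, n - 1 - j) * (- 1) ^ j"
proof -
  have "(\<Sum>r<n. A $$ (i, r) * w0_bar n $$ (r, j)) = (\<Sum>r\<in>{n - 1 - j}. A $$ (i, r) * w0_bar n $$ (r, j))"
    using ij by (intro sum.mono_neutral_right) (auto simp: w0_bar_eq)
  then show ?thesis using ij index_mult_mat_sum[OF A w0_bar_carrier, of i j] by (simp add: w0_bar_eq)
qed

lemma w0_bar_mult:
  assumes A: "A \<in> carrier_mat n n" and ij: "i < n" "j < n"
  shows "(w0_bar n * A) $$ (i, j) = (- 1) ^ (n - 1 - i) * A $$ (n - 1 - i, j)"
proof -
  have "(\<Sum>r<n. w0_bar n $$ (i, r) * A $$ (r, j)) = (\<Sum>r\<in>{n - 1 - i}. w0_bar n $$ (i, r) * A $$ (r, j))"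
    using ij by (intro sum.mono_neutral_right) (auto simp: w0_bar_eq)
  then show ?thesis using ij index_mult_mat_sum[OF w0_bar_carrier A, of i j] by (simp add: w0_bar_eq)
qed

section \<open>Uniqueness and existence of the factorisation
  \<open>u1 * d * w0_bar n * u2\<close>\<close>

lemma mult_carrier_square:
  "A \<in> carrier_mat n n \<Longrightarrow> B \<in> carrier_mat n n \<Longrightarrow> A * B \<in> carrier_mat n n"
  by simp

lemmas square_assoc = assoc_mult_mat[of _ n n _ n _ n for n] mult_carrier_square
  right_mult_one_mat[of _ n n for n] left_mult_one_mat[of _ n n for n]

lemma mult_torus_index:
  fixes A :: "'a::comm_ring_1 mat"
  assumes "A \<in> carrier_mat n n" "d \<in> torus n" "i < n" "j < n"
  shows "(A * d) $$ (i, j) = A $$ (i, j) * d $$ (j, j)"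
  using assms by (subst torusD(2)[OF assms(2)]) (simp add: mat_diag_mult_right[of _ n])

lemma torus_mult_index:
  fixes A :: "'a::comm_ring_1 mat"
  assumes "A \<in> carrier_mat n n" "d \<in> torus n" "i < n" "j < n"
  shows "(d * A) $$ (i, j) = d $$ (i, i) * A $$ (i, j)"
  using assms by (subst torusD(2)[OF assms(2)]) (simp add: mat_diag_mult_left[of _ n n])

text \<open>Moving unipotent factors across leaves
  \<open>v * d * w0_bar n = d' * (w0_bar n * z)\<close> with \<open>v\<close> and \<open>z\<close>
  unipotent. Up to the column reversal by \<open>w0_bar\<close>, the left side is upper and the
  right side lower triangular, so both are diagonal.\<close>

lemma bruhat_unique:
  fixes u1 :: "'a::comm_ring_1 mat"
  assumes u: "u1 \<in> unipotent_upper n" "u1' \<in> unipotent_upper n" "u2 \<in> unipotent_upper n"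
      "u2' \<in> unipotent_upper n"
    and d: "d \<in> torus n" "d' \<in> torus n"
    and eq: "u1 * d * w0_bar n * u2 = u1' * d' * w0_bar n * u2'"
  shows "u1 = u1' \<and> d = d' \<and> u2 = u2'"
proof -
  obtain x where x: "x \<in> unipotent_upper n" "x * u1' = 1\<^sub>m n" "u1' * x = 1\<^sub>m n"
    using unipotent_upper_inverse[OF u(2)] by metis
  obtain y where y: "y \<in> unipotent_upper n" "u2 * y = 1\<^sub>m n" "y * u2 = 1\<^sub>m n"
    using unipotent_upper_inverse[OF u(3)] by metis
  have c: "u1 \<in> carrier_mat n n" "u1' \<in> carrier_mat n n" "u2 \<in> carrier_mat n n" "u2' \<in> carrier_mat n n"
    "d \<in> carrier_mat n n" "d' \<in> carrier_mat n n" "x \<in> carrier_mat n n" "y \<in> carrier_mat n n"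
    using u d x y torusD(1) by (auto simp: unipotent_upper_iff)
  define v where "v = x * u1"
  define z where "z = u2' * y"
  have v: "v \<in> unipotent_upper n" unfolding v_def using x u by (intro unipotent_upper_mult)
  have z: "z \<in> unipotent_upper n" unfolding z_def using y u by (intro unipotent_upper_mult)
  have vz: "v \<in> carrier_mat n n" "z \<in> carrier_mat n n"
    "upper_triangular v" "upper_triangular z" "\<And>i. i < n \<Longrightarrow> v $$ (i, i) = 1" "\<And>i. i < n \<Longrightarrow> z $$ (i, i) = 1"
    using v z by (auto simp: unipotent_upper_iff)
  have "x * (u1 * d * w0_bar n * u2) * y = (x * u1) * d * w0_bar n * (u2 * y)"
    using c by (simp add: square_assoc[where n = n])
  then have "x * (u1 * d * w0_bar n * u2) * y = v * d * w0_bar n"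
    using c y(2) unfolding v_def by (simp add: square_assoc[where n = n])
  moreover have "x * (u1' * d' * w0_bar n * u2') * y = (x * u1') * d' * (w0_bar n * (u2' * y))"
    using c by (simp add: square_assoc[where n = n])
  ultimately have main: "v * d * w0_bar n = d' * (w0_bar n * z)"
    using x(2) c unfolding eq z_def by (metis left_mult_one_mat)
  \<comment> \<open>Reading column \<open>n - 1 - j\<close> undoes the reversal: it is column
    \<open>j\<close> of \<open>v * d\<close> up to sign.\<close>
  have L: "(v * d * w0_bar n) $$ (i, n - 1 - j) = v $$ (i, j) * d $$ (j, j) * (- 1) ^ (n - 1 - j)"
    if "i < n" "j < n" for i j
    using that c vz mult_w0_bar[of "v * d" n i "n - 1 - j"] mult_torus_index[OF vz(1) d(1), of i j]
    by (simp del: index_mult_mat(1))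
  have R: "(d' * (w0_bar n * z)) $$ (i, n - 1 - j) = d' $$ (i, i) * ((- 1) ^ (n - 1 - i) * z $$ (n - 1 - i, n - 1 - j))"
    if "i < n" "j < n" for i j
    using that c vz w0_bar_mult[of z n i "n - 1 - j"]
      torus_mult_index[OF mult_carrier_square[OF w0_bar_carrier vz(2)] d(2), of i "n - 1 - j"]
    by (simp del: index_mult_mat(1))
  have LR: "v $$ (i, j) * d $$ (j, j) * (- 1) ^ (n - 1 - j)
      = d' $$ (i, i) * ((- 1) ^ (n - 1 - i) * z $$ (n - 1 - i, n - 1 - j))"
    if "i < n" "j < n" for i j
    using L[OF that] R[OF that] main by simp
  have s: "(- 1) ^ k * ((- 1) ^ k * (a :: 'a)) = a" for k a
    by (simp add: mult.assoc[symmetric] power_add[symmetric])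
  have dd: "d = d'"
  proof -
    have "d $$ (i, i) = d' $$ (i, i)" if "i < n" for i
    proof -
      have "d $$ (i, i) * (- 1) ^ (n - 1 - i) = d' $$ (i, i) * (- 1) ^ (n - 1 - i)"
        using LR[OF that that] vz that by simp
      then have "(- 1) ^ (n - 1 - i) * ((- 1) ^ (n - 1 - i) * d $$ (i, i))
          = (- 1) ^ (n - 1 - i) * ((- 1) ^ (n - 1 - i) * d' $$ (i, i))"
        by (simp only: mult.commute)
      then show ?thesis by (simp only: s)
    qed
    then show ?thesis by (subst torusD(2)[OF d(1)], subst torusD(2)[OF d(2)]) (auto intro!: eq_matI simp: mat_diag_def)
  qed
  \<comment> \<open>The matching entry of \<open>z\<close> lies below its diagonal. The diagonal
    entry of \<open>d\<close> is removed by multiplying with its inverse, as cancellation may fail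
    in the ring.\<close>
  have v1: "v $$ (i, j) = 0" if ij: "i < j" "j < n" for i j
  proof -
    obtain e where e: "d $$ (j, j) * e = 1" using torusD(4)[OF d(1) ij(2)] by blast
    have "v $$ (i, j) * d $$ (j, j) * (- 1) ^ (n - 1 - j) = 0"
      using LR[of i j] ij vz by (simp add: upper_triangular_def)
    then have "(v $$ (i, j) * d $$ (j, j) * (- 1) ^ (n - 1 - j)) * ((- 1) ^ (n - 1 - j) * e) = 0" by simp
    moreover have "(v $$ (i, j) * d $$ (j, j) * (- 1) ^ (n - 1 - j)) * ((- 1) ^ (n - 1 - j) * e)
        = (- 1) ^ (n - 1 - j) * ((- 1) ^ (n - 1 - j) * v $$ (i, j)) * (d $$ (j, j) * e)"
      by (simp only: ac_simps)
    ultimately show ?thesis using e by (simp only: s) simp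
  qed
  have z1: "z $$ (i, j) = 0" if lt: "i < j" "j < n" for i j
  proof -
    let ?i = "n - 1 - i" and ?j = "n - 1 - j"
    obtain e where e: "d' $$ (?i, ?i) * e = 1" using torusD(4)[OF d(2), of ?i] lt by auto
    have ij: "n - 1 - ?i = i" "n - 1 - ?j = j" "?i < n" "?j < n" "?j < ?i" using lt by auto
    have "d' $$ (?i, ?i) * ((- 1) ^ i * z $$ (i, j)) = 0"
      using LR[of ?i ?j] ij vz by (simp add: upper_triangular_def)
    then have "((- 1) ^ i * e) * (d' $$ (?i, ?i) * ((- 1) ^ i * z $$ (i, j))) = 0" by simp
    moreover have "((- 1) ^ i * e) * (d' $$ (?i, ?i) * ((- 1) ^ i * z $$ (i, j)))
        = (- 1) ^ i * ((- 1) ^ i * z $$ (i, j)) * (d' $$ (?i, ?i) * e)"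
      by (simp only: ac_simps)
    ultimately show ?thesis using e by (simp only: s) simp
  qed
  have one: "A = 1\<^sub>m n" if "A \<in> carrier_mat n n" "upper_triangular A" "\<And>i. i < n \<Longrightarrow> A $$ (i, i) = 1"
    "\<And>i j. i < j \<Longrightarrow> j < n \<Longrightarrow> A $$ (i, j) = 0" for A :: "'a mat"
    using that by (intro eq_matI) (auto simp: upper_triangular_def, metis linorder_neqE_nat)
  have "v = 1\<^sub>m n" "z = 1\<^sub>m n" using one vz v1 z1 by blast+
  then have "u1' * (x * u1) = u1'" "(u2' * y) * u2 = u2" using c by (simp_all add: v_def z_def)
  moreover have "u1' * (x * u1) = u1' * x * u1" "(u2' * y) * u2 = u2' * (y * u2)"
    using c by (simp_all add: square_assoc[where n = n])
  ultimately show ?thesis using dd x y c by simp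
qed

text \<open>Uniqueness of the factors lets both definite descriptions be evaluated on any given
  factorisation, in particular on one written down over the dual numbers.\<close>

lemma hw_superpotential_eq:
  fixes u1 :: "'a::comm_ring_1 mat"
  assumes "u1 \<in> unipotent_upper n" "u2 \<in> unipotent_upper n" "d \<in> torus n"
    and "b = u1 * d * w0_bar n * u2"
  shows "hw n b = d" and "superpotential n b = chi n u1 + chi n u2"
proof -
  have uniq: "u1 = v1 \<and> d = e \<and> u2 = v2"
    if "v1 \<in> unipotent_upper n" "v2 \<in> unipotent_upper n" "e \<in> torus n" "b = v1 * e * w0_bar n * v2" for v1 e v2
    using bruhat_unique[of u1 n v1 u2 v2 d e] assms that by simp
  show "hw n b = d" unfolding hw_def
  proof (rule the_equality)
    show "d \<in> torus n \<and> (\<exists>u1\<in>unipotent_upper n. \<exists>u2\<in>unipotent_upper n. b = u1 * d * w0_bar n * u2)"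
      using assms by blast
  qed (use uniq in blast)
  show "superpotential n b = chi n u1 + chi n u2" unfolding superpotential_def
  proof (rule the_equality)
    show "\<exists>v1\<in>unipotent_upper n. \<exists>d\<in>torus n. \<exists>v2\<in>unipotent_upper n.
        b = v1 * d * w0_bar n * v2 \<and> chi n u1 + chi n u2 = chi n v1 + chi n v2"
      using assms by blast
  qed (use uniq in blast)
qed

text \<open>The two Borel factors are scaled to unipotent ones; the diagonal part of the right
  factor passes through \<open>w0_bar\<close>, which reverses the order of its entries.\<close>

lemma Z_decomposition:
  fixes b :: "'a::field mat"
  assumes "b \<in> Z n"
  obtains u1 d u2 where "u1 \<in> unipotent_upper n" "u2 \<in> unipotent_upper n" "d \<in> torus n"
    "b = u1 * d * w0_bar n * u2"
proof -
  obtain b1 b2 where b: "b = b1 * w0_bar n * b2" "b1 \<in> borel_upper n" "b2 \<in> borel_upper n"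
    using assms unfolding Z_def by blast
  have nz: "A $$ (i, i) \<noteq> 0" if A: "A \<in> borel_upper n" and i: "i < n" for i and A :: "'a mat"
  proof -
    from A have "A \<in> GL n" "upper_triangular A" by (auto simp: borel_upper_def)
    then obtain B where B: "A \<in> carrier_mat n n" "upper_triangular A" "B \<in> carrier_mat n n" "B * A = 1\<^sub>m n" "A * B = 1\<^sub>m n"
      unfolding GL_iff by blast
    from upper_triangular_inverse(2)[OF B i] show ?thesis by auto
  qed
  have c: "b1 \<in> carrier_mat n n" "b2 \<in> carrier_mat n n" "upper_triangular b1" "upper_triangular b2"
    using b by (auto simp: borel_upper_def GL_def)
  define u1 where "u1 = b1 * mat_diag n (\<lambda>i. 1 / b1 $$ (i, i))"
  define u2 where "u2 = mat_diag n (\<lambda>i. 1 / b2 $$ (i, i)) * b2"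
  let ?D1 = "mat_diag n (\<lambda>i. b1 $$ (i, i))" and ?D2 = "mat_diag n (\<lambda>i. b2 $$ (i, i))"
  let ?D3 = "mat_diag n (\<lambda>i. b2 $$ (n - 1 - i, n - 1 - i))"
  have u1: "u1 \<in> unipotent_upper n" and u2: "u2 \<in> unipotent_upper n"
    using c nz b unfolding u1_def u2_def unipotent_upper_iff mat_diag_mult_left[OF c(2)] mat_diag_mult_right[OF c(1)]
    by (auto simp: upper_triangular_def)
  have e1: "b1 = u1 * ?D1"
    unfolding u1_def using c nz b by (intro eq_matI) (auto simp: mat_diag_mult_right[of _ n])
  have e2: "b2 = ?D2 * u2"
    unfolding u2_def using c nz b by (intro eq_matI) (auto simp: mat_diag_mult_left[of _ n n])
  have e3: "w0_bar n * ?D2 = ?D3 * w0_bar n"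
    by (intro eq_matI) (auto simp: mat_diag_mult_right[of _ n] mat_diag_mult_left[of _ n n] w0_bar_eq)
  have uc: "u1 \<in> carrier_mat n n" "u2 \<in> carrier_mat n n" using u1 u2 by (auto simp: unipotent_upper_iff)
  have "b = u1 * ?D1 * w0_bar n * (?D2 * u2)" using b(1) e1 e2 by metis
  also have "\<dots> = u1 * ?D1 * (w0_bar n * ?D2) * u2"
    using uc by (simp add: square_assoc[where n = n])
  also have "\<dots> = u1 * (?D1 * ?D3) * w0_bar n * u2"
    unfolding e3 using uc by (simp add: square_assoc[where n = n] del: mat_diag_diag)
  finally have "b = u1 * mat_diag n (\<lambda>i. b1 $$ (i, i) * b2 $$ (n - 1 - i, n - 1 - i)) * w0_bar n * u2"
    by simp
  moreover have "mat_diag n (\<lambda>i. b1 $$ (i, i) * b2 $$ (n - 1 - i, n - 1 - i)) \<in> torus n"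
    by (rule mat_diag_torus[of _ _ "\<lambda>i. 1 / (b1 $$ (i, i) * b2 $$ (n - 1 - i, n - 1 - i))"])
      (use nz b in simp)
  ultimately show thesis using that u1 u2 by blast
qed

section \<open>Critical points are Toeplitz matrices\<close>

definition dual_mat :: "'a::comm_ring_1 mat \<Rightarrow> 'a mat \<Rightarrow> 'a dual_number mat" where
  "dual_mat A B = mat (dim_row A) (dim_col A) (\<lambda>(i, j). Dual (A $$ (i, j)) (B $$ (i, j)))"

lemma dual_mat_carrier [simp]: "A \<in> carrier_mat n m \<Longrightarrow> dual_mat A B \<in> carrier_mat n m"
  by (auto simp: dual_mat_def)

lemma dual_mat_index [simp]:
  "i < dim_row A \<Longrightarrow> j < dim_col A \<Longrightarrow> dual_mat A B $$ (i, j) = Dual (A $$ (i, j)) (B $$ (i, j))"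
  "dim_row (dual_mat A B) = dim_row A" "dim_col (dual_mat A B) = dim_col A"
  by (auto simp: dual_mat_def)

lemma sum_Dual: "(\<Sum>i\<in>I. Dual (f i) (g i)) = Dual (\<Sum>i\<in>I. f i) (\<Sum>i\<in>I. g i)"
  by (induction I rule: infinite_finite_induct) (auto simp: zero_dual_number_def plus_dual_number_def)

lemma dual_mat_mult:
  assumes "A \<in> carrier_mat n n" "B \<in> carrier_mat n n" "A' \<in> carrier_mat n n" "B' \<in> carrier_mat n n"
  shows "dual_mat A B * dual_mat A' B' = dual_mat (A * A') (A * B' + B * A')"
  using assms
  by (intro eq_matI) (auto simp: index_mult_mat_sum[of _ n n _ n] times_dual_number_def sum_Dual sum.distrib
      simp del: index_mult_mat(1))

lemmas w0_bar_dim [simp] = carrier_matD[OF w0_bar_carrier]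

text \<open>\<open>w0_bar\<close> occurs at two ring types. Recognising the instance over the dual
  numbers as a constant matrix makes the product rule applicable to it.\<close>

lemma dual_mat_w0_bar: "dual_mat (w0_bar n) (0\<^sub>m n n) = w0_bar n"
proof -
  have "Dual ((- 1) ^ k) 0 = ((- 1) ^ k :: 'a dual_number)" for k
  proof (induction k)
    case (Suc k)
    have "Dual ((- 1) ^ Suc k) 0 = - 1 * Dual ((- 1) ^ k :: 'a) 0"
      by (simp add: one_dual_number_def uminus_dual_number_def times_dual_number_def)
    then show ?case unfolding Suc by simp
  qed (simp add: one_dual_number_def)
  then show ?thesis
    by (intro eq_matI) (auto simp: w0_bar_eq zero_dual_number_def)
qed

lemma dual_mat_unipotent:
  assumes "u \<in> unipotent_upper n" "A \<in> carrier_mat n n" "\<And>i j. i < n \<Longrightarrow> j \<le> i \<Longrightarrow> A $$ (i, j) = 0"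
  shows "dual_mat u A \<in> unipotent_upper n"
  using assms unfolding unipotent_upper_iff
  by (auto simp: upper_triangular_def zero_dual_number_def one_dual_number_def)

lemma dual_mat_one: "dual_mat (1\<^sub>m n) (0\<^sub>m n n) = 1\<^sub>m n"
  by (intro eq_matI) (auto simp: zero_dual_number_def one_dual_number_def)

lemma dual_mat_torus:
  assumes "d \<in> torus n"
  shows "dual_mat d (0\<^sub>m n n) \<in> torus n"
proof -
  have d: "d \<in> carrier_mat n n" "diagonal_mat d" "d \<in> GL n" using assms by (auto simp: torus_def GL_def)
  then obtain e where e: "e \<in> carrier_mat n n" "d * e = 1\<^sub>m n" "e * d = 1\<^sub>m n" unfolding GL_iff by blast
  have "dual_mat d (0\<^sub>m n n) \<in> GL n"
    unfolding GL_iff using d e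
    by (auto intro!: bexI[of _ "dual_mat e (0\<^sub>m n n)"] simp: dual_mat_mult dual_mat_one)
  then show ?thesis using d by (auto simp: torus_def diagonal_mat_def zero_dual_number_def)
qed

text \<open>The square of \<open>w0_bar n\<close> is the scalar \<open>(- 1) ^ (n - 1)\<close>, so
  up to sign the matrix is its own inverse.\<close>

lemma w0_bar_GL: "(w0_bar n :: 'a::comm_ring_1 mat) \<in> GL n"
proof -
  let ?w = "w0_bar n :: 'a mat"
  define B where "B = mat n n (\<lambda>(i, j). (- 1) ^ (n - 1) * ?w $$ (i, j))"
  have B: "B \<in> carrier_mat n n" by (simp add: B_def)
  have sgn: "(- 1) ^ (n - 1 - i) * (- 1) ^ i = (- 1 :: 'a) ^ (n - 1)" if "i < n" for i
    using that by (simp flip: power_add)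
  have sgn2: "(- 1) ^ (n - 1) * (- 1) ^ (n - 1) = (1 :: 'a)"
    by (simp flip: power_add mult_2)
  have "(?w * B) $$ (i, j) = (if i = j then 1 else 0)" if "i < n" "j < n" for i j
  proof -
    have "(?w * B) $$ (i, j) = (- 1) ^ (n - 1) * ((- 1) ^ (n - 1 - i) * ?w $$ (n - 1 - i, j))"
      unfolding w0_bar_mult[OF B that] using that by (simp add: B_def)
    also have "(- 1) ^ (n - 1 - i) * ?w $$ (n - 1 - i, j) = (if i = j then (- 1) ^ (n - 1) else 0)"
      using that sgn[of i] by (auto simp: w0_bar_eq)
    finally show ?thesis using sgn2 by simp
  qed
  moreover have "(B * ?w) $$ (i, j) = (if i = j then 1 else 0)" if "i < n" "j < n" for i j
  proof -
    have "(B * ?w) $$ (i, j) = (- 1) ^ (n - 1) * (?w $$ (i, n - 1 - j) * (- 1) ^ j)"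
      unfolding mult_w0_bar[OF B that] using that by (simp add: B_def mult.assoc)
    also have "?w $$ (i, n - 1 - j) * (- 1) ^ j = (if i = j then (- 1) ^ (n - 1) else 0)"
      using that sgn[of j] by (auto simp: w0_bar_eq)
    finally show ?thesis using sgn2 by simp
  qed
  ultimately have "?w * B = 1\<^sub>m n" "B * ?w = 1\<^sub>m n"
    using B by (auto intro!: eq_matI simp del: index_mult_mat(1))
  then show ?thesis unfolding GL_iff using B by auto
qed

text \<open>As \<open>chi\<close> is the pairing \<open>N \<mapsto> tr (F N)\<close> with the
  subdiagonal shift \<open>F\<close>, the derivative in the direction of a strictly upper triangular
  \<open>N1\<close> is the trace of \<open>N1\<close> times the difference of \<open>F\<close> and
  the conjugate of \<open>F\<close> by \<open>p\<close>. Matrix units \<open>N1\<close> detect the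
  strictly lower entries of this difference.\<close>

lemma critical_point_toeplitz:
  fixes p :: "'a::field mat"
  assumes crit: "critical_point n d p" and ij: "Suc i < n" "Suc j < n"
  shows "p $$ (Suc i, Suc j) = p $$ (i, j)"
proof -
  have pZ: "p \<in> Z n" "hw n p = d" using crit by (auto simp: critical_point_def Z_fibre_def)
  obtain u1 u2 where u: "u1 \<in> unipotent_upper n" "u2 \<in> unipotent_upper n" and d: "d \<in> torus n"
    and p: "p = u1 * d * w0_bar n * u2"
    using Z_decomposition[OF pZ(1)] hw_superpotential_eq(1) pZ(2) by metis
  have c: "u1 \<in> carrier_mat n n" "u2 \<in> carrier_mat n n" "d \<in> carrier_mat n n"
    using u torusD(1)[OF d] by (auto simp: unipotent_upper_iff)
  have plow: "p \<in> GL n" "upper_triangular (transpose_mat p)"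
    using pZ(1) by (auto simp: Z_def borel_lower_def)
  then obtain p' where p': "p' \<in> carrier_mat n n" "p * p' = 1\<^sub>m n" "p' * p = 1\<^sub>m n" and pc: "p \<in> carrier_mat n n"
    unfolding GL_iff by blast
  have "p'\<^sup>T * p\<^sup>T = 1\<^sub>m n" "p\<^sup>T * p'\<^sup>T = 1\<^sub>m n"
    using p' pc by (simp_all flip: transpose_mult[of _ n n _ n])
  then have p'low: "upper_triangular (transpose_mat p')"
    using upper_triangular_inverse(1)[of "p\<^sup>T" n "p'\<^sup>T"] plow(2) pc p'(1) by simp
  have low: "A $$ (i, j) = 0" if "upper_triangular A\<^sup>T" "A \<in> carrier_mat n n" "i < j" "j < n" for A :: "'a mat" and i j
    using that upper_triangularD[OF that(1,3)] by simp
  \<comment> \<open>\<open>S\<close> is the conjugate of \<open>F\<close> by \<open>p\<close>, where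
    \<open>F\<close> has its ones at the positions \<open>(i, i - 1)\<close> and \<open>p'\<close>
    is the inverse of \<open>p\<close>.\<close>
  define S where "S b a = (\<Sum>i=1..n - 1. p $$ (b, i) * p' $$ (i - 1, a))" for a b
  have S1: "S b a = (if b = Suc a then 1 else 0)" if ab: "a < b" "b < n" for a b
  proof -
    \<comment> \<open>The tangent vector \<open>q = (1 + \<epsilon> N1) p (1 + \<epsilon> N2)\<close> stays lower triangular because \<open>N2\<close> cancels
      the strictly upper part of \<open>p\<^sup>-\<^sup>1 N1 p\<close>.\<close>
    define N1 :: "'a mat" where "N1 = mat n n (\<lambda>(i, j). if i = a \<and> j = b then 1 else 0)"
    define Y where "Y = p' * (N1 * p)"
    define N2 where "N2 = mat n n (\<lambda>(i, j). if i < j then - Y $$ (i, j) else 0)"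
    define U1 where "U1 = dual_mat u1 (N1 * u1)"
    define U2 where "U2 = dual_mat u2 (u2 * N2)"
    define D where "D = dual_mat d (0\<^sub>m n n)"
    define q where "q = U1 * D * w0_bar n * U2"
    have Nc: "N1 \<in> carrier_mat n n" "N2 \<in> carrier_mat n n" "Y \<in> carrier_mat n n"
      using p' pc by (auto simp: N1_def N2_def Y_def)
    have N1u: "(N1 * u1) $$ (i, j) = (if i = a then u1 $$ (b, j) else 0)" if "i < n" "j < n" for i j
    proof -
      have "(\<Sum>r<n. N1 $$ (i, r) * u1 $$ (r, j)) = (\<Sum>r\<in>{b}. N1 $$ (i, r) * u1 $$ (r, j))"
        using that ab by (intro sum.mono_neutral_right) (auto simp: N1_def)
      then show ?thesis using that ab index_mult_mat_sum[OF Nc(1) c(1) that] by (simp add: N1_def)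
    qed
    have u2N: "(u2 * N2) $$ (i, j) = 0" if "i < n" "j \<le> i" for i j
    proof -
      have "u2 $$ (i, r) * N2 $$ (r, j) = 0" if "r < n" for r
        using that \<open>i < n\<close> \<open>j \<le> i\<close> u(2) by (cases "r < i") (auto simp: N2_def unipotent_upper_iff upper_triangular_def)
      then have "(\<Sum>r<n. u2 $$ (i, r) * N2 $$ (r, j)) = 0" by (intro sum.neutral) auto
      then show ?thesis using that index_mult_mat_sum[OF c(2) Nc(2), of i j] by simp
    qed
    have u2N1: "(u2 * N2) $$ (i - 1, i) = N2 $$ (i - 1, i)" if "i \<in> {1..n - 1}" for i
    proof -
      have i: "i - 1 < n" "i < n" "0 < i" using that by auto
      have "u2 $$ (i - 1, r) * N2 $$ (r, i) = 0" if "r < n" "r \<noteq> i - 1" for r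
        using that i u(2) by (cases "r < i - 1") (auto simp: N2_def unipotent_upper_iff upper_triangular_def)
      then have "(\<Sum>r<n. u2 $$ (i - 1, r) * N2 $$ (r, i)) = (\<Sum>r\<in>{i - 1}. u2 $$ (i - 1, r) * N2 $$ (r, i))"
        using i by (intro sum.mono_neutral_right) auto
      then show ?thesis using i u(2) index_mult_mat_sum[OF c(2) Nc(2) i(1,2)] by (simp add: unipotent_upper_iff)
    qed
    have N1u0: "(N1 * u1) $$ (i, j) = 0" if "i < n" "j \<le> i" for i j
      using N1u[of i j] that u(1) ab
      by (auto simp: unipotent_upper_iff upper_triangular_def simp del: index_mult_mat(1))
    have U: "U1 \<in> unipotent_upper n" "U2 \<in> unipotent_upper n"
      unfolding U1_def U2_def
      by (rule dual_mat_unipotent[OF u(1) mult_carrier_square[OF Nc(1) c(1)] N1u0];assumption)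
        (rule dual_mat_unipotent[OF u(2) mult_carrier_square[OF c(2) Nc(2)] u2N];assumption)
    have D: "D \<in> torus n" unfolding D_def by (rule dual_mat_torus[OF d])
    have q: "q = dual_mat p (N1 * p + p * N2)"
    proof -
      have "U1 * D = dual_mat (u1 * d) (N1 * u1 * d)"
        unfolding U1_def D_def using c Nc by (simp add: dual_mat_mult)
      then have "U1 * D * w0_bar n = dual_mat (u1 * d * w0_bar n) (N1 * u1 * d * w0_bar n)"
        using c Nc by (simp add: dual_mat_mult[of _ n] left_add_zero_mat[of _ n n] mult_carrier_square[where n = n]
            flip: dual_mat_w0_bar)
      then have "q = dual_mat p (u1 * d * w0_bar n * (u2 * N2) + N1 * u1 * d * w0_bar n * u2)"
        unfolding q_def U2_def p using c Nc by (simp add: dual_mat_mult[of _ n] mult_carrier_square[where n = n])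
      also have "u1 * d * w0_bar n * (u2 * N2) = p * N2"
        unfolding p using c Nc by (simp add: square_assoc[where n = n])
      also have "N1 * u1 * d * w0_bar n * u2 = N1 * p"
        unfolding p using c Nc by (simp add: square_assoc[where n = n])
      finally show ?thesis using pc Nc by (simp add: comm_add_mat[of _ n n])
    qed
    have "N1 * p + p * N2 = p * (Y + N2)"
    proof -
      have "p * Y = (p * p') * (N1 * p)"
        unfolding Y_def using pc p'(1) Nc by (simp add: square_assoc[where n = n])
      then have "p * Y = N1 * p" unfolding p' using pc Nc by simp
      then show ?thesis using pc Nc by (simp add: mult_add_distrib_mat[of _ n n _ n])
    qed
    \<comment> \<open>\<open>Y + N2\<close> is \<open>Y\<close> with its strictly upper part
      deleted, hence lower triangular like \<open>p\<close>.\<close>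
    moreover have "(p * (Y + N2)) $$ (i, j) = 0" if "i < j" "j < n" for i j
    proof -
      have "p $$ (i, r) * (Y + N2) $$ (r, j) = 0" if "r < n" for r
        using that \<open>i < j\<close> \<open>j < n\<close> Nc low[OF plow(2) pc, of i r]
        by (cases "i < r") (auto simp: N2_def)
      then have "(\<Sum>r<n. p $$ (i, r) * (Y + N2) $$ (r, j)) = 0" by (intro sum.neutral) auto
      then show ?thesis using that Nc pc index_mult_mat_sum[of p n n "Y + N2" n i j]
        by (simp del: index_mult_mat(1) index_add_mat(1))
    qed
    ultimately have qlow: "q $$ (i, j) = 0" if "i < j" "j < n" for i j
      using that pc low[OF plow(2) pc that] unfolding q by (simp add: zero_dual_number_def del: index_mult_mat(1) index_add_mat(1))
    have Uc: "U1 \<in> carrier_mat n n" "U2 \<in> carrier_mat n n" "D \<in> carrier_mat n n" "q \<in> carrier_mat n n"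
      using U torusD(1)[OF D] pc q by (auto simp: unipotent_upper_iff)
    have GLs: "U1 \<in> GL n" "U2 \<in> GL n" "D \<in> GL n"
      using U D by (auto simp: unipotent_upper_def borel_upper_def torus_def)
    have "q \<in> GL n" unfolding q_def using GLs by (intro GL_mult w0_bar_GL)
    then have "q \<in> borel_lower n"
      using qlow Uc by (auto simp: borel_lower_def intro!: upper_triangularI)
    moreover have "U1 * D \<in> borel_upper n" "U2 \<in> borel_upper n"
      using U torusD(3)[OF D] by (auto intro: borel_upper_mult simp: unipotent_upper_def)
    ultimately have "q \<in> Z n" unfolding Z_def using q_def by blast
    moreover have hq: "hw n q = D" "superpotential n q = chi n U1 + chi n U2"
      using hw_superpotential_eq[OF U D q_def] by auto
    moreover have "D = map_mat dual_const d"
      unfolding D_def using c by (intro eq_matI) auto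
    moreover have "map_mat dual_std q = p"
      unfolding q using pc by (intro eq_matI) auto
    ultimately have "dual_eps (chi n U1 + chi n U2) = 0"
      using crit by (auto simp: critical_point_def Z_fibre_def)
    moreover have "chi n U1 = Dual (chi n u1) (\<Sum>i=1..n - 1. (N1 * u1) $$ (i - 1, i))"
      unfolding chi_def U1_def sum_Dual[symmetric] using c by (intro sum.cong) auto
    moreover have "chi n U2 = Dual (chi n u2) (\<Sum>i=1..n - 1. (u2 * N2) $$ (i - 1, i))"
      unfolding chi_def U2_def sum_Dual[symmetric] using c by (intro sum.cong) auto
    ultimately have "(\<Sum>i=1..n - 1. (N1 * u1) $$ (i - 1, i)) + (\<Sum>i=1..n - 1. (u2 * N2) $$ (i - 1, i)) = 0"
      by (simp add: plus_dual_number_def)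
    \<comment> \<open>Only row \<open>a\<close> of \<open>N1 * u1\<close> is non-zero, so the sum
      picks out \<open>u1 $$ (b, Suc a)\<close>, an entry on or below the diagonal of a unipotent
      matrix because \<open>a < b\<close>.\<close>
    moreover have "(\<Sum>i=1..n - 1. (N1 * u1) $$ (i - 1, i)) = (if b = Suc a then 1 else 0)"
    proof -
      have "(\<Sum>i=1..n - 1. (N1 * u1) $$ (i - 1, i)) = (\<Sum>i=1..n - 1. if i = Suc a then u1 $$ (b, i) else 0)"
        using c by (intro sum.cong refl) (auto simp: N1u simp del: index_mult_mat(1))
      also have "\<dots> = u1 $$ (b, Suc a)" using ab by simp
      also have "\<dots> = (if b = Suc a then 1 else 0)"
        using ab u(1) by (auto simp: unipotent_upper_iff upper_triangular_def)
      finally show ?thesis .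
    qed
    moreover have "(\<Sum>i=1..n - 1. (u2 * N2) $$ (i - 1, i)) = - S b a"
    proof -
      have "(u2 * N2) $$ (i - 1, i) = - (p $$ (b, i) * p' $$ (i - 1, a))" if i: "i \<in> {1..n - 1}" for i
      proof -
        have i': "i - 1 < n" "i < n" "i - 1 < i" using i by auto
        have N1p: "(N1 * p) $$ (r, i) = (if r = a then p $$ (b, i) else 0)" if "r < n" for r
        proof -
          have "(\<Sum>k<n. N1 $$ (r, k) * p $$ (k, i)) = (\<Sum>k\<in>{b}. N1 $$ (r, k) * p $$ (k, i))"
            using that ab i' by (intro sum.mono_neutral_right) (auto simp: N1_def)
          then show ?thesis using that i' ab index_mult_mat_sum[OF Nc(1) pc that i'(2)] by (simp add: N1_def)
        qed
        have "Y $$ (i - 1, i) = (\<Sum>r<n. p' $$ (i - 1, r) * (N1 * p) $$ (r, i))"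
          unfolding Y_def by (rule index_mult_mat_sum[OF p'(1) mult_carrier_square[OF Nc(1) pc] i'(1,2)])
        also have "\<dots> = (\<Sum>r<n. if r = a then p' $$ (i - 1, a) * p $$ (b, i) else 0)"
          by (intro sum.cong refl) (simp add: N1p del: index_mult_mat(1))
        also have "\<dots> = p $$ (b, i) * p' $$ (i - 1, a)" using ab by simp
        finally show ?thesis unfolding u2N1[OF i] using i' by (simp add: N2_def)
      qed
      then show ?thesis unfolding S_def by (simp add: sum_negf del: index_mult_mat(1))
    qed
    ultimately show ?thesis by simp
  qed
  have S2: "S b a = 0" if "b \<le> a" "a < n" for a b
  proof -
    have "p $$ (b, i) * p' $$ (i - 1, a) = 0" if i: "i \<in> {1..n - 1}" for i
    proof (cases "b < i")
      case True
      then show ?thesis using i low[OF plow(2) pc, of b i] by simp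
    next
      case False
      then have "i - 1 < a" using i \<open>b \<le> a\<close> by auto
      then show ?thesis using \<open>a < n\<close> low[OF p'low p'(1), of "i - 1" a] by simp
    qed
    then show ?thesis unfolding S_def by (intro sum.neutral) blast
  qed
  have S: "S b a = (if b = Suc a then 1 else 0)" if "a < n" "b < n" for a b
    using S1[of a b] S2[of b a] that by (cases "a < b") auto
  \<comment> \<open>The entry \<open>(Suc i, j)\<close> of \<open>S * p\<close> is computed twice.
    With the value of \<open>S\<close> it is the entry \<open>(i, j)\<close> of \<open>p\<close>;
    after cancelling \<open>p' * p\<close> it is the entry \<open>(Suc i, Suc j)\<close>.\<close>
  have "(\<Sum>a<n. S (Suc i) a * p $$ (a, j)) = (\<Sum>a<n. if a = i then p $$ (i, j) else 0)"
    using ij by (intro sum.cong refl) (simp add: S)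
  then have "p $$ (i, j) = (\<Sum>a<n. S (Suc i) a * p $$ (a, j))" using ij by simp
  also have "\<dots> = (\<Sum>a<n. \<Sum>k=1..n - 1. p $$ (Suc i, k) * (p' $$ (k - 1, a) * p $$ (a, j)))"
    by (simp add: S_def sum_distrib_right mult.assoc)
  also have "\<dots> = (\<Sum>k=1..n - 1. p $$ (Suc i, k) * (\<Sum>a<n. p' $$ (k - 1, a) * p $$ (a, j)))"
    unfolding sum_distrib_left by (rule sum.swap)
  also have "\<dots> = (\<Sum>k=1..n - 1. if k = Suc j then p $$ (Suc i, Suc j) else 0)"
  proof (intro sum.cong refl)
    fix k assume k: "k \<in> {1..n - 1}"
    then have "k - 1 < n" "j < n" using ij by auto
    then have "(\<Sum>a<n. p' $$ (k - 1, a) * p $$ (a, j)) = (p' * p) $$ (k - 1, j)"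
      by (rule index_mult_mat_sum[OF p'(1) pc, symmetric])
    then show "p $$ (Suc i, k) * (\<Sum>a<n. p' $$ (k - 1, a) * p $$ (a, j))
        = (if k = Suc j then p $$ (Suc i, Suc j) else 0)"
      using k ij unfolding p' by (cases k) auto
  qed
  also have "\<dots> = p $$ (Suc i, Suc j)" using ij by simp
  finally show ?thesis by simp
qed

section \<open>Ideal coordinates\<close>

lemma mult_y_mat:
  assumes A: "A \<in> carrier_mat n n" and k: "Suc k < n"
  shows "A * y_mat n (Suc k) z = mat n n (\<lambda>(i, j).
    if j = k then A $$ (i, k) + A $$ (i, Suc k) * z else A $$ (i, j))" (is "_ = ?R")
proof (rule eq_matI)
  fix i j assume "i < dim_row ?R" "j < dim_col ?R"
  then have ij: "i < n" "j < n" by auto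
  let ?f = "\<lambda>r. A $$ (i, r) * y_mat n (Suc k) z $$ (r, j)"
  let ?I = "if j = k then {k, Suc k} else {j}"
  have "(\<Sum>r<n. ?f r) = (\<Sum>r\<in>?I. ?f r)"
    using ij k by (intro sum.mono_neutral_right) (auto simp: y_mat_index)
  then show "(A * y_mat n (Suc k) z) $$ (i, j) = ?R $$ (i, j)"
    using ij k index_mult_mat_sum[OF A y_mat_carrier, of i j] by (simp add: y_mat_index)
qed (use A in simp_all)

text \<open>With increasing indices the off-diagonal parts of two factors multiply to 0, so nothing
  appears below the first subdiagonal.\<close>

lemma y_mat_block:
  "k < n \<Longrightarrow> mat_product n (map (\<lambda>r. y_mat n r (c r)) [1..<Suc k]) =
    (mat n n (\<lambda>(i, j). if i = j then 1 else if i = Suc j \<and> j < k then c i else 0) :: 'a::comm_ring_1 mat)"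
    (is "_ \<Longrightarrow> _ = ?M k")
proof (induction k)
  case 0
  then show ?case by (auto intro!: eq_matI)
next
  case (Suc k)
  have "[1..<Suc (Suc k)] = [1..<Suc k] @ [Suc k]" by simp
  then have "mat_product n (map (\<lambda>r. y_mat n r (c r)) [1..<Suc (Suc k)]) = ?M k * y_mat n (Suc k) (c (Suc k))"
    using Suc by (simp add: mat_product_append image_subset_iff mat_product_Cons right_mult_one_mat[of _ n n] del: upt_Suc)
  also have "\<dots> = ?M (Suc k)"
    using Suc.prems by (subst mult_y_mat) (auto intro!: eq_matI)
  finally show ?case .
qed

lemma s_index_1 [simp]: "s_index n (Suc 0) = 0" by (simp add: s_index_def)

lemma s_index_Suc: "1 \<le> j \<Longrightarrow> s_index n (Suc j) = s_index n j + (n - j)"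
  by (cases j) (simp_all add: s_index_def)

lemma s_index_top: "n \<ge> 1 \<Longrightarrow> s_index n n = n choose 2"
proof -
  assume n: "n \<ge> 1"
  have "s_index n n = (\<Sum>k=1..n - 1. k)"
    unfolding s_index_def using n by (subst sum.atLeastAtMost_rev) simp
  also have "\<dots> = n choose 2"
    using n gauss_sum_nat[of "n - 1"] by (simp add: choose_two sum.atLeast_Suc_atMost mult.commute)
  finally show ?thesis .
qed

lemma s_index_range:
  assumes "1 \<le> i" "i < j" "j \<le> n"
  shows "s_index n i + (j - i) \<in> {1..n choose 2}"
proof -
  have mono: "s_index n (Suc i) \<le> s_index n n"
  proof -
    have "s_index n (Suc i) \<le> s_index n l" if "Suc i \<le> l" for l
      using that by (induction l rule: dec_induct) (use assms in \<open>auto simp: s_index_Suc\<close>)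
    then show ?thesis using assms by simp
  qed
  then show ?thesis using assms s_index_Suc[of i n] s_index_top[of n] by auto
qed

text \<open>Block \<open>j\<close> is preceded by \<open>s_index n j\<close> letters; the final
  \<open>- 1\<close> passes from numbering from 1 to list positions.\<close>

lemma word_i0_nth:
  assumes "1 \<le> j" "j < n" "1 \<le> r" "r \<le> n - j"
  shows "word_i0 n ! (s_index n j + r - 1) = r"
proof -
  let ?g = "\<lambda>k. [1..<Suc (n - k)]"
  have len: "length (concat (map ?g [1..<Suc i])) = s_index n (Suc i)" for i
  proof (induction i)
    case (Suc i)
    have "[1..<Suc (Suc i)] = [1..<Suc i] @ [Suc i]" by simp
    then show ?case using Suc s_index_Suc[of "Suc i" n] by (simp del: upt_Suc)
  qed simp
  obtain i where i: "j = Suc i" using assms by (cases j) auto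
  have "[1..<n] = [1..<j] @ j # [Suc j..<n]"
    using assms upt_add_eq_append[of 1 j "n - j"] upt_conv_Cons[of j n] by simp
  then have w: "word_i0 n = concat (map ?g [1..<j]) @ ?g j @ concat (map ?g [Suc j..<n])"
    by (simp add: word_i0_def del: upt_Suc)
  have "s_index n j + r - 1 = length (concat (map ?g [1..<j])) + (r - 1)"
    using len[of i] i assms by simp
  then have "word_i0 n ! (s_index n j + r - 1) = (?g j @ concat (map ?g [Suc j..<n])) ! (r - 1)"
    unfolding w by (simp only: nth_append_length_plus)
  moreover have "r - 1 < n - j" using assms by auto
  ultimately show ?thesis using assms by (simp add: nth_append del: upt_Suc)
qed

text \<open>Groups the factors of \<open>psi\<close> by the blocks of the word, so that each group
  is one bidiagonal matrix.\<close>

lemma map_word_i0_blocks: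
  assumes "1 \<le> j" "j \<le> n"
  shows "map (\<lambda>k. f (word_i0 n ! (k - 1)) k) [1..<Suc (s_index n j)]
    = concat (map (\<lambda>i. map (\<lambda>r. f r (s_index n i + r)) [1..<Suc (n - i)]) [1..<j])"
  using assms
proof (induction j rule: dec_induct)
  case (step j)
  let ?s = "s_index n j"
  let ?h = "\<lambda>k. f (word_i0 n ! (k - 1)) k"
  have "[1..<Suc (s_index n (Suc j))] = [1..<Suc ?s] @ map (\<lambda>r. ?s + r) [1..<Suc (n - j)]"
    using step upt_add_eq_append[of 1 "Suc ?s" "n - j"] map_add_upt[of "?s" "Suc (n - j)"]
    by (intro nth_equalityI) (auto simp: s_index_Suc nth_append simp del: upt_Suc)
  then have "map ?h [1..<Suc (s_index n (Suc j))]
      = map ?h [1..<Suc ?s] @ map (\<lambda>r. ?h (?s + r)) [1..<Suc (n - j)]"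
    by (simp del: upt_Suc)
  also have "map (\<lambda>r. ?h (?s + r)) [1..<Suc (n - j)] = map (\<lambda>r. f r (?s + r)) [1..<Suc (n - j)]"
    using step word_i0_nth[of j n] by (intro map_cong) (auto simp del: upt_Suc)
  also have "map ?h [1..<Suc ?s] = concat (map (\<lambda>i. map (\<lambda>r. f r (s_index n i + r)) [1..<Suc (n - i)]) [1..<j])"
    using step by simp
  finally show ?case using step by simp
qed simp

text \<open>Multiplication by the next bidiagonal factor adds to column \<open>c\<close> a multiple
  of column \<open>c + 1\<close>, which is the recursion of \<open>factor_poly\<close>. Factor
  number \<open>s\<close> touches only the columns \<open>c < n - s\<close>, whence the
  minimum.\<close>

lemma y_product_index:
  fixes a :: "nat \<Rightarrow> nat \<Rightarrow> 'a::comm_ring_1"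
  assumes "s < n" "i < n" "c < n"
  shows "mat_product n (concat (map (\<lambda>i. map (\<lambda>r. y_mat n r (a i (i + r))) [1..<Suc (n - i)]) [1..<Suc s])) $$ (i, c)
    = (if i < c then 0 else let s' = min s (n - 1 - c) in
        coeff (factor_poly (\<lambda>s k. a s (n - k)) s' (n - 1 - c - s')) (i - c))"
  using assms
proof (induction s arbitrary: i c)
  case 0
  then show ?case by (auto simp: Let_def)
next
  case (Suc s)
  let ?blk = "\<lambda>i. map (\<lambda>r. y_mat n r (a i (i + r))) [1..<Suc (n - i)]"
  let ?b = "\<lambda>s k. a s (n - k)"
  let ?Y = "mat_product n (concat (map ?blk [1..<Suc s]))"
  let ?L = "mat_product n (?blk (Suc s))"
  have Yc: "?Y \<in> carrier_mat n n" "?L \<in> carrier_mat n n" by (rule mat_product_carrier; auto)+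
  have L: "?L = mat n n (\<lambda>(i, j). if i = j then 1 else if i = Suc j \<and> j < n - Suc s then a (Suc s) (Suc s + i) else 0)"
    using Suc.prems by (intro y_mat_block) simp
  have "[1..<Suc (Suc s)] = [1..<Suc s] @ [Suc s]" by simp
  then have "concat (map ?blk [1..<Suc (Suc s)]) = concat (map ?blk [1..<Suc s]) @ ?blk (Suc s)"
    by (simp del: upt_Suc)
  then have "mat_product n (concat (map ?blk [1..<Suc (Suc s)])) = ?Y * ?L"
    by (simp only:) (intro mat_product_append; auto)
  moreover have "(?Y * ?L) $$ (i, c) = ?Y $$ (i, c)
      + (if c < n - Suc s then ?Y $$ (i, Suc c) * a (Suc s) (Suc s + Suc c) else 0)"
  proof -
    let ?I = "if c < n - Suc s then {c, Suc c} else {c}"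
    have "(\<Sum>r<n. ?Y $$ (i, r) * ?L $$ (r, c)) = (\<Sum>r\<in>?I. ?Y $$ (i, r) * ?L $$ (r, c))"
      using Suc.prems unfolding L by (intro sum.mono_neutral_right) auto
    then show ?thesis
      using Suc.prems unfolding index_mult_mat_sum[OF Yc Suc.prems(2,3)] unfolding L by simp
  qed
  moreover have "?Y $$ (i, c) + (if c < n - Suc s then ?Y $$ (i, Suc c) * a (Suc s) (Suc s + Suc c) else 0)
      = (if i < c then 0 else let s' = min (Suc s) (n - 1 - c) in coeff (factor_poly ?b s' (n - 1 - c - s')) (i - c))"
  proof (cases "c < n - Suc s")
    case True
    \<comment> \<open>\<open>k\<close> is the second index of the polynomial for column
      \<open>c\<close> after \<open>Suc s\<close> factors. The parameter added there is the entry of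
      the new factor in row \<open>Suc c\<close>, that is \<open>a (Suc s) (n - k)\<close>.\<close>
    define k where "k = n - 2 - s - c"
    have k: "n - 1 - c = s + Suc k" "n - 1 - Suc c = s + k" "n - k = Suc s + Suc c"
      using True unfolding k_def by auto
    have "?Y $$ (i, c) = (if i < c then 0 else coeff (factor_poly ?b s (Suc k)) (i - c))"
      using Suc.IH[of i c] Suc.prems k by (simp add: Let_def del: upt_Suc)
    moreover have "?Y $$ (i, Suc c) = (if i < Suc c then 0 else coeff (factor_poly ?b s k) (i - Suc c))"
      using Suc.IH[of i "Suc c"] Suc.prems k True by (simp add: Let_def del: upt_Suc)
    moreover have "coeff (factor_poly ?b (Suc s) k) (i - c) = coeff (factor_poly ?b s (Suc k)) (i - c)
        + (if i - c = 0 then 0 else a (Suc s) (n - k) * coeff (factor_poly ?b s k) (i - c - 1))"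
      by (cases "i - c") (simp_all add: coeff_pCons)
    ultimately show ?thesis using True k
      by (auto simp: Let_def mult.commute simp del: upt_Suc factor_poly.simps)
  next
    case False
    then have "min s (n - 1 - c) = n - 1 - c" "min (Suc s) (n - 1 - c) = n - 1 - c" by auto
    then show ?thesis using False Suc.IH[of i c] Suc.prems by (simp del: upt_Suc factor_poly.simps)
  qed
  ultimately show ?case by (simp only:)
qed

text \<open>The product of the bidiagonal factors is unipotent, so constancy along the main diagonal
  makes \<open>t_R\<close> scalar. Cancelling this scalar shows that the product itself is Toeplitz,
  and \<open>toeplitz_factor_relation\<close> applies.\<close>

lemma psi_toeplitz_relation:
  fixes m :: "nat \<Rightarrow> 'a::field" and n :: nat
  defines "a \<equiv> \<lambda>i j. 1 / m (s_index n i + (j - i))"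
  assumes m: "\<And>k. k \<in> {1..n choose 2} \<Longrightarrow> m k \<noteq> 0" and d: "\<And>i. i < n \<Longrightarrow> d $$ (i, i) \<noteq> 0"
    and toep: "\<And>i j. Suc i < n \<Longrightarrow> Suc j < n \<Longrightarrow> psi n d m $$ (Suc i, Suc j) = psi n d m $$ (i, j)"
  shows "\<And>j. 1 \<le> j \<Longrightarrow> j < n \<Longrightarrow> t_R_entry n d m (Suc j) = t_R_entry n d m j"
    and "\<And>s J. 1 \<le> s \<Longrightarrow> s < J \<Longrightarrow> J < n \<Longrightarrow>
      (\<Prod>i=1..s. a i J / a i (Suc J)) + (\<Prod>j=Suc J..n. a (Suc s) j / a s j) = 1"
proof -
  let ?b = "\<lambda>s k. a s (n - k)"
  let ?t = "\<lambda>j. t_R_entry n d m (n - j)"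
  define Y where "Y = mat_product n (concat (map (\<lambda>i. map (\<lambda>r. y_mat n r (a i (i + r))) [1..<Suc (n - i)]) [1..<n]))"
  have Yc: "Y \<in> carrier_mat n n" unfolding Y_def by (rule mat_product_carrier) auto
  have "psi n d m $$ (i, j) = Y $$ (i, j) * ?t j" if "i < n" "j < n" for i j
  proof -
    have n: "1 \<le> n" using that by simp
    have "psi n d m = Y * t_R n d m"
      unfolding psi_def s_index_top[OF n, symmetric]
        map_word_i0_blocks[OF n order.refl, of "\<lambda>x k. y_mat n x (1 / m k)"]
      by (simp add: Y_def a_def del: upt_Suc)
    then show ?thesis using that Yc unfolding t_R_def mat_diag_mult_right[OF Yc] by simp
  qed note psi = this
  have Y: "Y $$ (i, c) = coeff (factor_poly ?b (n - 1 - c) 0) (i - c)" if "i < n" "c \<le> i" for i c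
  proof -
    have "Suc (n - 1) = n" "min (n - 1) (n - 1 - c) = n - 1 - c" using that by auto
    then show ?thesis
      using y_product_index[of "n - 1" n i c a] that by (simp add: Y_def Let_def del: upt_Suc factor_poly.simps)
  qed
  have Ydiag: "Y $$ (i, i) = 1" if "i < n" for i using Y[of i i] that by (simp add: coeff_factor_poly_0)
  have tS: "?t (Suc j) = ?t j" if "Suc j < n" for j
    using toep[OF that that] that psi Ydiag by simp
  show "t_R_entry n d m (Suc j) = t_R_entry n d m j" if "1 \<le> j" "j < n" for j
    using tS[of "n - Suc j"] that by (simp add: Suc_diff_Suc)
  show "(\<Prod>i=1..s. a i J / a i (Suc J)) + (\<Prod>j=Suc J..n. a (Suc s) j / a s j) = 1"
    if sJ: "1 \<le> s" "s < J" "J < n" for s J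
  proof -
    have a: "a i j \<noteq> 0" if "1 \<le> i" "i < j" "j \<le> n" for i j
      unfolding a_def using m[OF s_index_range[OF that]] by simp
    have t0: "?t j \<noteq> 0" if j: "j < n" for j
    proof -
      have "m (s_index n k + (n - j - k)) \<noteq> 0" if "k \<in> {1..n - j - 1}" for k
        using that j by (intro m s_index_range) auto
      moreover have "m (s_index n (n - j) + r) \<noteq> 0" if "r \<in> {1..n - (n - j)}" for r
      proof -
        have "s_index n (n - j) + ((n - j + r) - (n - j)) \<in> {1..n choose 2}"
          using that j by (intro s_index_range) auto
        then show ?thesis using m by simp
      qed
      moreover have "d $$ (n - j - 1, n - j - 1) \<noteq> 0" using d j by simp
      ultimately show ?thesis unfolding t_R_entry_def by (auto simp: prod_zero_iff)
    qed
    have YS: "Y $$ (Suc i, Suc j) = Y $$ (i, j)" if "Suc i < n" "Suc j < n" for i j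
      using toep[OF that] psi[of i j] psi[of "Suc i" "Suc j"] tS[of j] t0[of j] that by simp
    \<comment> \<open>Counted from the diagonal, adjacent columns of a Toeplitz matrix agree as far
      as the shorter one reaches. Their polynomials thus differ only in the last coefficient of the
      longer one.\<close>
    have toepY: "\<exists>x. factor_poly ?b (Suc s) 0 - factor_poly ?b s 0 = monom x (Suc s)" if s: "Suc s < n" for s
    proof (intro exI poly_eqI)
      fix t
      define c where "c = n - 2 - s"
      have c: "n - 1 - c = Suc s" "n - 1 - Suc c = s" "Suc c < n" "c + Suc s < n" using s by (auto simp: c_def)
      consider "t \<le> s" | "t = Suc s" | "t > Suc s" by linarith
      then show "coeff (factor_poly ?b (Suc s) 0 - factor_poly ?b s 0) t
          = coeff (monom (coeff (factor_poly ?b (Suc s) 0) (Suc s)) (Suc s)) t"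
      proof cases
        case 1
        have "coeff (factor_poly ?b (Suc s) 0) t = Y $$ (c + t, c)"
          using Y[of "c + t" c] c 1 by (simp del: factor_poly.simps)
        also have "\<dots> = Y $$ (Suc c + t, Suc c)" using YS[of "c + t" c] c 1 by simp
        also have "\<dots> = coeff (factor_poly ?b s 0) t" using Y[of "Suc c + t" "Suc c"] c 1 by (simp del: factor_poly.simps)
        finally show ?thesis using 1 by (simp del: factor_poly.simps)
      next
        case 2
        then show ?thesis using degree_factor_poly[of ?b s 0] by (simp add: coeff_eq_0 del: factor_poly.simps)
      next
        case 3
        then show ?thesis using degree_factor_poly[of ?b s 0] degree_factor_poly[of ?b "Suc s" 0]
          by (simp add: coeff_eq_0 del: factor_poly.simps)
      qed
    qed
    obtain s' where s': "s = Suc s'" using sJ by (cases s) auto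
    \<comment> \<open>The second index of \<open>?b\<close> counts columns from the right, so
      \<open>k\<close> and \<open>Suc k\<close> stand for the columns \<open>Suc J\<close> and
      \<open>J\<close>.\<close>
    define k where "k = n - Suc J"
    have k: "n - Suc k = J" "n - k = Suc J" "Suc s' + Suc k < n" "k < n" using sJ s' by (auto simp: k_def)
    have "(\<Prod>i=1..Suc s'. ?b i (Suc k) / ?b i k) + (\<Prod>j\<le>k. ?b (Suc (Suc s')) j / ?b (Suc s') j) = 1"
      by (rule toeplitz_factor_relation[where n = n]) (use a toepY k in auto)
    moreover have "(\<Prod>j\<le>k. ?b (Suc (Suc s')) j / ?b (Suc s') j) = (\<Prod>j=Suc J..n. a (Suc s) j / a s j)"
      by (rule prod.reindex_bij_witness[of _ "\<lambda>j. n - j" "\<lambda>j. n - j"]) (use sJ s' in \<open>auto simp: k_def\<close>)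
    ultimately show ?thesis unfolding k s'[symmetric] by simp
  qed
qed

section \<open>Valuations\<close>

text \<open>No coefficients occur below the valuations, so the pair of lowest exponents is the only
  one that sums to \<open>Val f + Val g\<close>.\<close>

lemma Val_mult:
  assumes "f \<noteq> 0" "g \<noteq> 0"
  shows "Val (f * g) = Val f + Val g"
    and "pcoeff (f * g) (Val f + Val g) = pcoeff f (Val f) * pcoeff g (Val g)"
proof -
  show lead: "pcoeff (f * g) (Val f + Val g) = pcoeff f (Val f) * pcoeff g (Val g)"
  proof -
    have "pcoeff (f * g) (Val f + Val g) = (\<Sum>(a, b)\<in>{(Val f, Val g)}. pcoeff f a * pcoeff g b)"
    proof (rule pcoeff_times_superset)
      fix a b assume ab: "a + b = Val f + Val g" "pcoeff f a \<noteq> 0" "pcoeff g b \<noteq> 0"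
      then have "Val f \<le> a" "Val g \<le> b" using assms Val_le by blast+
      then show "(a, b) \<in> {(Val f, Val g)}" using ab(1) by simp
    qed auto
    then show ?thesis by simp
  qed
  show "Val (f * g) = Val f + Val g"
    unfolding Val_def[of "f * g"]
  proof (rule Least_equality)
    show "pcoeff (f * g) (Val f + Val g) \<noteq> 0" unfolding lead using assms pcoeff_Val by simp
  next
    fix x assume "pcoeff (f * g) x \<noteq> 0"
    then obtain a b where ab: "a + b = x" "pcoeff f a \<noteq> 0" "pcoeff g b \<noteq> 0" by (rule supp_times)
    then have "Val f \<le> a" "Val g \<le> b" using assms Val_le by blast+
    then show "Val f + Val g \<le> x" using ab by simp
  qed
qed

lemma Val_tpow [simp]: "Val (tpow \<mu>) = \<mu>"
  unfolding Val_def by (rule Least_equality) (auto simp: tpow.rep_eq split: if_splits)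

lemma tpow_pos: "tpow \<mu> \<in> puiseux_pos"
proof -
  have "pcoeff (tpow \<mu>) \<mu> = 1" by (simp add: tpow.rep_eq)
  then show ?thesis unfolding puiseux_pos_def
    by (auto simp: zero_puiseux.rep_eq intro!: exI[of _ 1])
qed

lemma one_eq_tpow: "1 = tpow 0"
  by (rule puiseux_eqI) (simp add: one_puiseux.rep_eq tpow.rep_eq)

lemma Val_one [simp]: "Val 1 = 0" by (simp add: one_eq_tpow)

lemma one_pos: "1 \<in> puiseux_pos" by (simp add: one_eq_tpow tpow_pos)

lemma puiseux_pos_nonzero: "f \<in> puiseux_pos \<Longrightarrow> f \<noteq> 0" by (simp add: puiseux_pos_def)

lemma puiseux_pos_mult: "f \<in> puiseux_pos \<Longrightarrow> g \<in> puiseux_pos \<Longrightarrow> f * g \<in> puiseux_pos"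
  using Val_mult[of f g] by (auto simp: puiseux_pos_def) (metis mult_pos_pos of_real_mult)

lemma Val_divide:
  assumes "f \<noteq> 0" "g \<noteq> 0"
  shows "Val (f / g) = Val f - Val g"
  using Val_mult(1)[of "f / g" g] assms by simp

lemma puiseux_pos_divide:
  assumes "f \<in> puiseux_pos" "g \<in> puiseux_pos"
  shows "f / g \<in> puiseux_pos"
proof -
  have nz: "f \<noteq> 0" "g \<noteq> 0" using assms puiseux_pos_nonzero by auto
  obtain r s where rs: "r > 0" "s > 0" "pcoeff f (Val f) = complex_of_real r" "pcoeff g (Val g) = complex_of_real s"
    using assms unfolding puiseux_pos_def by auto
  have "pcoeff f (Val f) = pcoeff (f / g) (Val (f / g)) * pcoeff g (Val g)"
    using Val_mult[of "f / g" g] nz by simp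
  then have "pcoeff (f / g) (Val (f / g)) = complex_of_real (r / s)" using rs by (simp add: field_simps)
  then show ?thesis using nz rs unfolding puiseux_pos_def by (auto intro!: exI[of _ "r / s"])
qed

lemma puiseux_pos_prod: "(\<And>i. i \<in> I \<Longrightarrow> f i \<in> puiseux_pos) \<Longrightarrow> prod f I \<in> puiseux_pos"
  by (induction I rule: infinite_finite_induct) (auto intro: one_pos puiseux_pos_mult)

lemma Val_prod: "(\<And>i. i \<in> I \<Longrightarrow> f i \<noteq> 0) \<Longrightarrow> Val (prod f I) = (\<Sum>i\<in>I. Val (f i))"
  by (induction I rule: infinite_finite_induct) (auto simp: Val_mult)

text \<open>Leading coefficients that are positive reals cannot cancel. This is what turns an
  identity between sums into one between minima.\<close>

lemma Val_add_pos:
  assumes "f \<in> puiseux_pos" "g \<in> puiseux_pos"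
  shows "Val (f + g) = min (Val f) (Val g)"
proof -
  have nz: "f \<noteq> 0" "g \<noteq> 0" using assms puiseux_pos_nonzero by auto
  obtain r s where rs: "r > 0" "s > 0" "pcoeff f (Val f) = complex_of_real r" "pcoeff g (Val g) = complex_of_real s"
    using assms unfolding puiseux_pos_def by auto
  have low: "pcoeff f x = 0" if "x < Val f" for x using Val_le[OF nz(1), of x] that by force
  have low': "pcoeff g x = 0" if "x < Val g" for x using Val_le[OF nz(2), of x] that by force
  show ?thesis unfolding Val_def[of "f + g"]
  proof (rule Least_equality)
    have "complex_of_real r + complex_of_real s \<noteq> 0"
      using rs by (metis add_pos_pos less_numeral_extra(3) of_real_add of_real_eq_0_iff)
    then show "pcoeff (f + g) (min (Val f) (Val g)) \<noteq> 0"
      using rs low[of "Val g"] low'[of "Val f"]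
      by (cases "Val f" "Val g" rule: linorder_cases) (auto simp: plus_puiseux.rep_eq min_def)
  next
    fix x assume "pcoeff (f + g) x \<noteq> 0"
    then show "min (Val f) (Val g) \<le> x"
      using low[of x] low'[of x] by (force simp: plus_puiseux.rep_eq)
  qed
qed

text \<open>The constant \<open>V\<close> is arbitrary at first; the weight equations force it to be
  the mean of \<open>lam\<close>. Dominance enters through \<open>ideal_nonneg\<close>.\<close>

lemma ideal_filling_forI:
  fixes f :: "nat \<Rightarrow> nat \<Rightarrow> real"
  assumes n: "n \<ge> 1" and dom: "dominant n lam"
    and ideal: "\<And>i j. 1 \<le> i \<Longrightarrow> j \<le> n \<Longrightarrow> i + 2 \<le> j \<Longrightarrow> f i j = max (f (i + 1) j) (f i (j - 1))"
    and weight: "\<And>k. k \<in> {1..n} \<Longrightarrow> lam k = V + ((\<Sum>l=k+1..n. f k l) - (\<Sum>i=1..<k. f i k))"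
  shows "ideal_filling_for n lam f"
proof -
  have "(\<Sum>l=j+2..n. f (j + 1) l) - (\<Sum>k=1..j. f k (j + 1)) \<le> (\<Sum>l=j+1..n. f j l) - (\<Sum>k=1..<j. f k j)"
    if "1 \<le> j" "j < n" for j
  proof -
    have "lam (j + 1) \<le> lam j" using dom that by (simp add: dominant_def)
    moreover have "{1..<j + 1} = {1..j}" by auto
    ultimately show ?thesis using weight[of j] weight[of "j + 1"] that by simp
  qed
  then have nonneg: "0 \<le> f i j" if "1 \<le> i" "i < j" "j \<le> n" for i j
    using ideal_nonneg[of n f, OF ideal] that by blast
  define T where "T k = (\<Sum>i=1..n. \<Sum>j=i + 1..n. f i j * alpha_vec i j k)" for k
  have T: "T k = (\<Sum>l=k+1..n. f k l) - (\<Sum>i=1..<k. f i k)" if k: "k \<in> {1..n}" for k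
  proof -
    have "T k = (\<Sum>i=1..n. \<Sum>j=i + 1..n. f i j * eps_vec i k) - (\<Sum>i=1..n. \<Sum>j=i + 1..n. f i j * eps_vec j k)"
      by (simp add: T_def alpha_vec_def right_diff_distrib sum_subtractf)
    also have "(\<Sum>i=1..n. \<Sum>j=i + 1..n. f i j * eps_vec i k) = (\<Sum>i=1..n. if i = k then \<Sum>j=k + 1..n. f k j else 0)"
      by (intro sum.cong) (auto simp: eps_vec_def)
    also have "\<dots> = (\<Sum>l=k+1..n. f k l)" using k by simp
    also have "(\<Sum>i=1..n. \<Sum>j=i + 1..n. f i j * eps_vec j k) = (\<Sum>i=1..n. if i < k then f i k else 0)"
    proof (intro sum.cong refl)
      fix i
      have "(\<Sum>j=i + 1..n. f i j * eps_vec j k) = (\<Sum>j=i + 1..n. if j = k then f i k else 0)"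
        by (intro sum.cong) (auto simp: eps_vec_def)
      then show "(\<Sum>j=i + 1..n. f i j * eps_vec j k) = (if i < k then f i k else 0)" using k by simp
    qed
    also have "\<dots> = (\<Sum>i=1..<k. f i k)"
      using k by (intro sum.mono_neutral_cong_right) auto
    finally show ?thesis .
  qed
  \<comment> \<open>The coordinates of every root sum to 0, so adding the weight equations over all
    \<open>k\<close> leaves only \<open>real n * V\<close>.\<close>
  have "(\<Sum>k=1..n. T k) = (\<Sum>i=1..n. \<Sum>k=1..n. \<Sum>j=i + 1..n. f i j * alpha_vec i j k)"
    unfolding T_def by (rule sum.swap)
  also have "\<dots> = (\<Sum>i=1..n. \<Sum>j=i + 1..n. \<Sum>k=1..n. f i j * alpha_vec i j k)"
    by (intro sum.cong refl sum.swap)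
  also have "\<dots> = 0"
  proof (rule sum.neutral, rule ballI, rule sum.neutral, rule ballI)
    fix i j assume "i \<in> {1..n}" "j \<in> {i + 1..n}"
    then have "(\<Sum>k=1..n. alpha_vec i j k) = 0"
      by (simp add: alpha_vec_def eps_vec_def sum_subtractf)
    then show "(\<Sum>k=1..n. f i j * alpha_vec i j k) = 0" by (simp flip: sum_distrib_left)
  qed
  finally have "(\<Sum>k=1..n. lam k) = real n * V"
    using weight T by (simp add: sum.distrib)
  then have V: "(\<Sum>k=1..n. lam k) / real n = V" using n by simp
  have "(\<Sum>i=1..n. eps_vec i k) = 1" if "k \<in> {1..n}" for k
    using that by (simp add: eps_vec_def)
  then show ?thesis
    unfolding ideal_filling_for_def ideal_filling_def filling_def Let_def V
    using nonneg ideal weight T unfolding T_def by (simp add: add.commute)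
qed

theorem corollary5p4p8:
  fixes n :: nat and lam :: "nat \<Rightarrow> real" and p :: "puiseux mat"
    and m :: "nat \<Rightarrow> puiseux" and mu :: "nat \<Rightarrow> real"
  assumes "n \<ge> 2"
    and "dominant n lam"
    and "positive_critical_point n lam p"
    and "m \<in> positive_coords n" and "p = psi n (t_weight n lam) m"
    and "\<And>k. k \<in> {1..n choose 2} \<Longrightarrow> mu k = Val (m k)"
  shows "ideal_filling_for n lam (\<lambda>i j. mu (s_index n i + (j - i)))"
proof -
  let ?d = "t_weight n lam"
  \<comment> \<open>\<open>A i j\<close> is the valuation of \<open>a i j\<close>; the inversion of
    \<open>m\<close> changes the sign, so a minimum for \<open>A\<close> becomes a maximum for
    \<open>mu\<close>.\<close>
  define A where "A i j = - mu (s_index n i + (j - i))" for i j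
  define a where "a i j = 1 / m (s_index n i + (j - i))" for i j
  have pos: "m k \<in> puiseux_pos" if "k \<in> {1..n choose 2}" for k
    using assms(4) that by (simp add: positive_coords_def)
  have nz: "m k \<noteq> 0" if "k \<in> {1..n choose 2}" for k
    using pos[OF that] puiseux_pos_nonzero by blast
  have d: "?d $$ (i, i) = tpow (lam (i + 1))" if "i < n" for i
    using that by (simp add: t_weight_def mat_diag_def)
  have tnz: "tpow x \<noteq> 0" for x using tpow_pos puiseux_pos_nonzero by blast
  have toep: "psi n ?d m $$ (Suc i, Suc j) = psi n ?d m $$ (i, j)" if "Suc i < n" "Suc j < n" for i j
    using assms(3) critical_point_toeplitz[of n ?d p, OF _ that] unfolding assms(5)[symmetric]
    by (simp add: positive_critical_point_def)
  have dnz: "?d $$ (i, i) \<noteq> 0" if "i < n" for i using d[OF that] tnz by simp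
  have tS: "t_R_entry n ?d m (Suc j) = t_R_entry n ?d m j" if "1 \<le> j" "j < n" for j
    by (rule psi_toeplitz_relation(1)) (use nz dnz toep that in blast)+
  have rel: "(\<Prod>i=1..s. a i J / a i (Suc J)) + (\<Prod>j=Suc J..n. a (Suc s) j / a s j) = 1"
    if "1 \<le> s" "s < J" "J < n" for s J
    unfolding a_def by (rule psi_toeplitz_relation(2)[where d = ?d]) (use nz dnz toep that in blast)+
  have apos: "a i j \<in> puiseux_pos" "a i j \<noteq> 0" "Val (a i j) = A i j" if "1 \<le> i" "i < j" "j \<le> n" for i j
    using s_index_range[OF that] pos one_pos nz assms(6) puiseux_pos_divide puiseux_pos_nonzero
    by (auto simp: a_def A_def Val_divide)
  have ideal: "A s (Suc J) = min (A s J) (A (Suc s) (Suc J))" if sJ: "1 \<le> s" "s < J" "J < n" for s J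
  proof (rule tropical_ideal[where n = n])
    fix s J assume sJ: "1 \<le> s" "s < J" "J < n"
    have P: "(\<Prod>i=1..s. a i J / a i (Suc J)) \<in> puiseux_pos"
      using sJ by (intro puiseux_pos_prod puiseux_pos_divide apos) auto
    have Q: "(\<Prod>j=Suc J..n. a (Suc s) j / a s j) \<in> puiseux_pos"
      using sJ by (intro puiseux_pos_prod puiseux_pos_divide apos) auto
    have "Val (\<Prod>i=1..s. a i J / a i (Suc J)) = (\<Sum>i=1..s. A i J - A i (Suc J))"
      using sJ apos by (subst Val_prod) (auto simp: Val_divide intro!: sum.cong)
    moreover have "Val (\<Prod>j=Suc J..n. a (Suc s) j / a s j) = (\<Sum>j=Suc J..n. A (Suc s) j - A s j)"
      using sJ apos by (subst Val_prod) (auto simp: Val_divide intro!: sum.cong)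
    \<comment> \<open>The two positive products add up to 1, whose valuation is 0.\<close>
    moreover note rel[OF sJ]
    ultimately show "min (\<Sum>i=1..s. A i J - A i (Suc J)) (\<Sum>j=Suc J..n. A (Suc s) j - A s j) = 0"
      using Val_add_pos[OF P Q] by simp
  qed (use sJ in auto)
  let ?f = "\<lambda>i j. mu (s_index n i + (j - i))"
  have fA: "?f i j = - A i j" for i j by (simp add: A_def)
  \<comment> \<open>Since \<open>t_R\<close> is scalar, this valuation is the same for all
    \<open>j\<close>; solved for \<open>lam j\<close> it becomes the weight condition.\<close>
  have ValT: "Val (t_R_entry n ?d m j) = lam j + (\<Sum>i=1..<j. ?f i j) - (\<Sum>l=j + 1..n. ?f j l)"
    if j: "j \<in> {1..n}" for j
  proof -
    have k: "s_index n i + (j - i) \<in> {1..n choose 2}" if "i \<in> {1..j - 1}" for i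
      using that j by (intro s_index_range) auto
    have r: "s_index n j + r \<in> {1..n choose 2}" if "r \<in> {1..n - j}" for r
      using s_index_range[of j "j + r" n] that j by auto
    have nz1: "(\<Prod>k=1..j - 1. m (s_index n k + (j - k))) \<noteq> 0" "(\<Prod>r=1..n - j. m (s_index n j + r)) \<noteq> 0"
      using k r nz by (auto simp: prod_zero_iff)
    have "j - 1 < n" using j by auto
    then have "?d $$ (j - 1, j - 1) = tpow (lam j)" using d[of "j - 1"] j by simp
    then have "Val (t_R_entry n ?d m j) = lam j + Val (\<Prod>k=1..j - 1. m (s_index n k + (j - k)))
        - Val (\<Prod>r=1..n - j. m (s_index n j + r))"
      unfolding t_R_entry_def using nz1 tnz by (simp add: Val_divide Val_mult)
    also have "Val (\<Prod>k=1..j - 1. m (s_index n k + (j - k))) = (\<Sum>i=1..<j. ?f i j)"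
    proof -
      have "{1..j - 1} = {1..<j}" using j by auto
      moreover have "Val (\<Prod>k=1..j - 1. m (s_index n k + (j - k))) = (\<Sum>k=1..j - 1. ?f k j)"
        by (subst Val_prod) (use k nz assms(6)[OF k] in \<open>auto intro!: sum.cong simp del: atLeastAtMost_iff\<close>)
      ultimately show ?thesis by simp
    qed
    also have "Val (\<Prod>r=1..n - j. m (s_index n j + r)) = (\<Sum>r=1..n - j. mu (s_index n j + r))"
      using r nz assms(6) by (subst Val_prod) (auto intro!: sum.cong)
    also have "\<dots> = (\<Sum>l=j + 1..n. ?f j l)"
      by (rule sum.reindex_bij_witness[of _ "\<lambda>l. l - j" "\<lambda>r. j + r"]) auto
    finally show ?thesis .
  qed
  have const: "t_R_entry n ?d m j = t_R_entry n ?d m 1" if "1 \<le> j" "j \<le> n" for j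
    using that by (induction j rule: dec_induct) (use tS in auto)
  show ?thesis
  proof (rule ideal_filling_forI[where V = "Val (t_R_entry n ?d m 1)"])
    show "lam k = Val (t_R_entry n ?d m 1) + ((\<Sum>l=k + 1..n. ?f k l) - (\<Sum>i=1..<k. ?f i k))"
      if "k \<in> {1..n}" for k
      using ValT[OF that] const[of k] that by simp
    \<comment> \<open>The tropical relation is used with \<open>s = i\<close> and
      \<open>J = j - 1\<close>; the bound \<open>i + 2 \<le> j\<close> gives
      \<open>s < J\<close>.\<close>
    show "?f i j = max (?f (i + 1) j) (?f i (j - 1))" if "1 \<le> i" "j \<le> n" "i + 2 \<le> j" for i j
      using ideal[of i "j - 1"] that unfolding fA by (simp add: max_def min_def)
  qed (use assms in auto)
qed

end
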